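(* Let $\mathcal{D}\subseteq\omega$ be an at most countable set of digits, let $\mathcal{I}=\{I_n=[\ell_n,r_n): n\in\mathcal{D}\}$ be a family of pairwise disjoint nonempty intervals contained in $[0,1]$ with $\sum_{n\in\mathcal{D}}(r_n-\ell_n)=1$, and let $\epsilon\colon\mathcal{D}\to\{0,1\}$ be a function. Then the set of numbers $x\in[0,1]$ which are normal for the $(\mathcal{I},\epsilon)$-GLS expansion is $\mathbf{\Pi}^0_3$-complete.
   Context: $\omega=\{0,1,2,\ldots\}$. Put $I_\infty=[0,1]\setminus\bigcup_{n\in\mathcal{D}}I_n$. The generalized GLS expansion map $T=T_{\mathcal{I},\epsilon}\colon[0,1]\to[0,1]$ is defined by: $T(x)=0$ for $x\in I_\infty$; for $n\in\mathcal{D}$, the restriction of $T$ to $I_n$ is the affine map with positive slope from $I_n=[\ell_n,r_n)$ onto $[0,1)$ if $\epsilon(n)=0$, and the affine map with negative slope from $I_n$ onto $(0,1]$ if $\epsilon(n)=1$. Let $\lambda$ be Lebesgue measure on $[0,1]$. A real $x\in[0,1]$ is normal for the $(\mathcal{I},\epsilon)$-GLS expansion if $x$ generates $\lambda$, i.e. $\lim_{N\to\infty}\frac1N|\{0\le n<N: T^n(x)\in I\}|=\lambda(I)$ for every interval $I\subseteq[0,1]$. In $[0,1]$: $\mathbf{\Sigma}^0_1$ = open sets, $\mathbf{\Pi}^0_k$ = complements of $\mathbf{\Sigma}^0_k$ sets, $\mathbf{\Sigma}^0_{k+1}$ = countable unions of $\mathbf{\Pi}^0_k$ sets. A set is $\mathbf{\Pi}^0_3$-complete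 if it is in $\mathbf{\Pi}^0_3\setminus\mathbf{\Sigma}^0_3$.
   Formalization: The digit set D is assumed to have more than one element; with a single digit the interval is [0,1), T is x or 1−x there, all orbits are finite, so the set of normal numbers is empty and is not Π^0_3-complete. *)

theory Defs
  imports "HOL-Analysis.Analysis"
begin

section \<open>Finite levels of the Borel hierarchy of a topological space\<close>

text \<open>Levels are numbered from 1; level 0 is a dummy value.\<close>

fun bold_Sigma :: "'a topology \<Rightarrow> nat \<Rightarrow> 'a set set" where
  "bold_Sigma X 0 = {}"
| "bold_Sigma X (Suc 0) = {U. openin X U}"
| "bold_Sigma X (Suc (Suc k)) =
     {\<Union>F | F. countable F \<and> F \<subseteq> (\<lambda>A. topspace X - A) ` bold_Sigma X (Suc k)}"

definition bold_Pi :: "'a topology \<Rightarrow> nat \<Rightarrow> 'a set set" where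
  "bold_Pi X k = (\<lambda>A. topspace X - A) ` bold_Sigma X k"

lemma bold_Sigma_Suc_Suc:
  "bold_Sigma X (Suc (Suc k)) = {\<Union>F | F. countable F \<and> F \<subseteq> bold_Pi X (Suc k)}"
  by (simp add: bold_Pi_def)

definition Pi3_complete :: "'a topology \<Rightarrow> 'a set \<Rightarrow> bool" where
  "Pi3_complete X A \<longleftrightarrow> A \<in> bold_Pi X 3 - bold_Sigma X 3"


section \<open>Generalized GLS expansions\<close>

text \<open>The interval family is given by the endpoint functions \<open>l\<close> and \<open>r\<close>;
  all three functions \<open>l\<close>, \<open>r\<close>, \<open>e\<close> matter only on the digit set \<open>D\<close>.
  As \<open>D\<close> consists of natural numbers, it is automatically at most countable.\<close>

definition GLS_data :: "nat set \<Rightarrow> (nat \<Rightarrow> real) \<Rightarrow> (nat \<Rightarrow> real) \<Rightarrow> (nat \<Rightarrow> nat) \<Rightarrow> bool" where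
  "GLS_data D l r e \<longleftrightarrow>
     (\<forall>n\<in>D. {l n..<r n} \<noteq> {} \<and> {l n..<r n} \<subseteq> {0..1}) \<and>
     disjoint_family_on (\<lambda>n. {l n..<r n}) D \<and>
     ((\<lambda>n. r n - l n) has_sum 1) D \<and>
     e ` D \<subseteq> {0, 1}"

text \<open>On \<open>[l n, r n)\<close> the map is the increasing affine bijection onto \<open>[0, 1)\<close> if
  \<open>e n = 0\<close>, and the decreasing affine bijection onto \<open>(0, 1]\<close> if \<open>e n = 1\<close>.
  The digit \<open>n\<close> of \<open>x\<close> is unique when the intervals are disjoint.\<close>

definition GLS_map :: "nat set \<Rightarrow> (nat \<Rightarrow> real) \<Rightarrow> (nat \<Rightarrow> real) \<Rightarrow> (nat \<Rightarrow> nat) \<Rightarrow> real \<Rightarrow> real" where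
  "GLS_map D l r e x =
     (if x \<in> (\<Union>n\<in>D. {l n..<r n})
      then let n = (THE n. n \<in> D \<and> x \<in> {l n..<r n})
           in if e n = 0 then (x - l n) / (r n - l n) else (r n - x) / (r n - l n)
      else 0)"

text \<open>The intervals \<open>J\<close> may be open, closed, half-open or degenerate.\<close>

definition GLS_normal :: "nat set \<Rightarrow> (nat \<Rightarrow> real) \<Rightarrow> (nat \<Rightarrow> real) \<Rightarrow> (nat \<Rightarrow> nat) \<Rightarrow> real \<Rightarrow> bool" where
  "GLS_normal D l r e x \<longleftrightarrow>
     (\<forall>J. is_interval J \<and> J \<subseteq> {0..1} \<longrightarrow>
        (\<lambda>N. real (card {n. n < N \<and> (GLS_map D l r e ^^ n) x \<in> J}) / real N)
          \<longlonglongrightarrow> measure (lebesgue_on {0..1}) J)"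

lemma GLS_map_eq:
  assumes "GLS_data D l r e" "n \<in> D" "x \<in> {l n..<r n}"
  shows "GLS_map D l r e x = (if e n = 0 then (x - l n) / (r n - l n) else (r n - x) / (r n - l n))"
proof -
  have "(THE n. n \<in> D \<and> x \<in> {l n..<r n}) = n"
  proof (rule the_equality)
    show "n \<in> D \<and> x \<in> {l n..<r n}" using assms by blast
    fix m assume "m \<in> D \<and> x \<in> {l m..<r m}"
    then show "m = n"
      using assms unfolding GLS_data_def disjoint_family_on_def by blast
  qed
  then show ?thesis using assms(2,3) by (auto simp: GLS_map_def Let_def)
qed

text \<open>With a single digit the interval is \<open>[0, 1)\<close> and every orbit is finite, so there are no
  normal numbers; statements about the size of the set of normal numbers have to exclude
  singleton digit sets.\<close>

lemma not_GLS_normal_singleton: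
  assumes "GLS_data {d} l r e" and x: "x \<in> {0..1}"
  shows "\<not> GLS_normal {d} l r e x"
proof
  assume norm: "GLS_normal {d} l r e x"
  let ?T = "GLS_map {d} l r e"
  have rl: "r d - l d = 1"
    using assms(1) has_sum_finite_iff[of "{d}" "\<lambda>n. r n - l n" 1] by (simp add: GLS_data_def)
  have sub: "{l d..<r d} \<subseteq> {0..1}" using assms(1) by (auto simp: GLS_data_def)
  have "l d \<in> {l d..<r d}" using rl by auto
  with sub have l0: "l d \<ge> 0" by auto
  have "r d \<le> 1"
  proof (rule ccontr)
    assume "\<not> r d \<le> 1"
    then have "(max 1 (l d) + r d) / 2 \<in> {l d..<r d}" "(max 1 (l d) + r d) / 2 > 1" using rl by auto
    with sub show False by fastforce
  qed
  with l0 rl have lr: "l d = 0" "r d = 1" by auto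
  have T: "?T y = (if e d = 0 then y else 1 - y)" if "y \<in> {0..<1}" for y
    using GLS_map_eq[OF assms(1), of d y] that lr by auto
  have T1: "?T 1 = 0" by (simp add: GLS_map_def lr)
  have orb: "(?T ^^ n) x \<in> {0, 1, x, 1 - x}" for n
  proof (induction n)
    case (Suc n)
    have "?T y \<in> {0, 1, x, 1 - x}" if "y \<in> {0, 1, x, 1 - x}" for y
      using that x T[of y] T1 by (cases "y = 1") (auto split: if_splits)
    with Suc show ?case by simp
  qed simp
  have False if J: "J = {a<..<b}" "0 \<le> a" "a < b" "b \<le> 1" and avoid: "x \<notin> J" "1 - x \<notin> J" for J a b
  proof -
    have "(?T ^^ n) x \<notin> J" for n
      using orb[of n] J avoid by auto
    then have "(\<lambda>N. real (card {n. n < N \<and> (?T ^^ n) x \<in> J}) / real N) = (\<lambda>N. 0)"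
      by simp
    moreover have J01: "is_interval J" "J \<subseteq> {0..1}"
      using J by (auto simp: is_interval_oo)
    then have "(\<lambda>N. real (card {n. n < N \<and> (?T ^^ n) x \<in> J}) / real N)
                 \<longlonglongrightarrow> measure (lebesgue_on {0..1}) J"
      using norm unfolding GLS_normal_def by blast
    ultimately have "(\<lambda>N. 0) \<longlonglongrightarrow> measure (lebesgue_on {0..1}) J"
      by metis
    then have "measure (lebesgue_on {0..1}) J = 0" by (simp add: LIMSEQ_const_iff)
    moreover have "measure (lebesgue_on {0..1}) J = b - a"
      using J J01(2) by (simp add: measure_restrict_space)
    ultimately show False using J by simp
  qed
  note hit = this
  have "x \<in> {0<..<1/4} \<or> 1 - x \<in> {0<..<1/4}"
    using hit[of "{0<..<1/4}" 0 "1/4"] by argo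
  moreover have "x \<in> {1/4<..<1/2} \<or> 1 - x \<in> {1/4<..<1/2}"
    using hit[of "{1/4<..<1/2}" "1/4" "1/2"] by argo
  ultimately show False by auto
qed

end

theory Submission imports Defs begin

text \<open>Upper bound: on the \<open>G\<^sub>\<delta>\<close> set of points whose orbit stays in the open intervals
  \<open>(l n, r n)\<close>, all iterates of the map are continuous, and points outside of it are not normal
  because their orbit ends in \<open>{0, 1}\<close>. On this set, normality says that the visit frequencies of
  all closed rational intervals have sufficiently large lower limits, which is a \<open>\<Pi>\<^sub>3\<close> condition.

  Lower bound: a greedy choice of digits, which keeps a weighted sum of squared martingales small,
  yields a digit sequence in which each word has its expected frequency. Overwriting the first
  \<open>1 / (a i + 1)\<close>-th part of the \<open>i\<close>-th dyadic block with a constant digit gives a point which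
  depends continuously on \<open>a\<close> and is normal iff \<open>a\<close> tends to infinity. A fusion argument
  shows that the sequences of natural numbers tending to infinity are not a countable union of
  \<open>G\<^sub>\<delta>\<close> sets.\<close>

section \<open>Visit frequencies\<close>

text \<open>The obstacle is the endpoints: \<open>T\<close> may jump there, and the points in no
  interval form a null set that can be uncountable. But \<open>{0, 1}\<close> is absorbing for
  \<open>T\<close>, and an orbit caught in it is not equidistributed, so endpoints only ever lead to
  non-normal points. This also allows the lower bound to follow shifted digit sequences instead of
  \<open>T\<close>-orbits. A second digit supplies a contraction constant below 1, which makes the
  coding continuous and long runs of one digit rare. Dyadic blocks are used because a block makes up
  half of the time up to its end: overwriting a fixed proportion of infinitely many blocks stays
  visible in the frequencies at those ends, while proportions tending to 0 have density 0. Only one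
  word-normal sequence is needed, so a deterministic choice of digits replaces an almost-everywhere
  argument.\<close>

definition freq :: "(nat \<Rightarrow> bool) \<Rightarrow> nat \<Rightarrow> real" where
  "freq P N = real (card {n. n < N \<and> P n}) / real N"

lemma freq_sum: "freq P N = (\<Sum>n<N. of_bool (P n)) / real N"
proof -
  have "(\<Sum>n<N. of_bool (P n) :: real) = real (card ({..<N} \<inter> {n. P n}))"
    by (subst sum_of_bool_eq) auto
  also have "{..<N} \<inter> {n. P n} = {n. n < N \<and> P n}" by auto
  finally show ?thesis by (simp add: freq_def)
qed

lemma freq_nonneg: "0 \<le> freq P N"
  by (simp add: freq_def)

lemma freq_mono:
  assumes "\<And>n. P n \<Longrightarrow> Q n"
  shows "freq P N \<le> freq Q N"
  unfolding freq_sum by (intro divide_right_mono sum_mono) (auto simp: assms)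

lemma freq_disjoint_le:
  assumes "\<And>n. \<not> (P n \<and> Q n)"
  shows "freq P N + freq Q N \<le> 1"
proof -
  have "(\<Sum>n<N. of_bool (P n)) + (\<Sum>n<N. of_bool (Q n)) \<le> (\<Sum>n<N. 1::real)"
    unfolding sum.distrib[symmetric] using assms by (intro sum_mono) auto
  then show ?thesis
    by (cases "N = 0") (auto simp: freq_sum add_divide_distrib[symmetric])
qed

lemma freq_Un:
  assumes "finite W" and "\<And>n v w. v \<in> W \<Longrightarrow> w \<in> W \<Longrightarrow> P v n \<Longrightarrow> P w n \<Longrightarrow> v = w"
  shows "freq (\<lambda>n. \<exists>w\<in>W. P w n) N = (\<Sum>w\<in>W. freq (P w) N)"
proof -
  have "(\<Sum>w\<in>W. of_bool (P w n)) = (of_bool (\<exists>w\<in>W. P w n) :: real)" for n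
  proof (cases "\<exists>w\<in>W. P w n")
    case True
    then obtain v where v: "v \<in> W" "P v n" by blast
    then have "P w n \<longleftrightarrow> w = v" if "w \<in> W" for w using assms(2) that by blast
    then have "(\<Sum>w\<in>W. of_bool (P w n) :: real) = (\<Sum>w\<in>W. of_bool (w = v))"
      by (intro sum.cong) auto
    also have "\<dots> = 1" using v assms(1) by (simp add: of_bool_def sum.delta)
    finally show ?thesis using True by simp
  qed auto
  then show ?thesis
    unfolding freq_sum sum_divide_distrib[symmetric] by (subst sum.swap) simp
qed

lemma freq_eventually_zero:
  assumes "\<And>n. m \<le> n \<Longrightarrow> \<not> P n"
  shows "freq P \<longlonglongrightarrow> 0"
proof (rule tendsto_sandwich[of "\<lambda>N. 0" _ _ "\<lambda>N. real m / real N"])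
  have "card {n. n < N \<and> P n} \<le> card {..<m}" for N
    by (intro card_mono subsetI) (auto intro: ccontr dest: assms leI)
  then show "\<forall>\<^sub>F N in sequentially. freq P N \<le> real m / real N"
    by (auto simp: freq_def intro!: always_eventually divide_right_mono)
  show "(\<lambda>N. real m / real N) \<longlonglongrightarrow> 0" by (simp add: lim_const_over_n)
qed (auto simp: freq_nonneg)

definition equidistributed :: "(nat \<Rightarrow> real) \<Rightarrow> bool" where
  "equidistributed y \<longleftrightarrow>
     (\<forall>J. is_interval J \<and> J \<subseteq> {0..1} \<longrightarrow>
        freq (\<lambda>n. y n \<in> J) \<longlonglongrightarrow> measure (lebesgue_on {0..1}) J)"

lemma GLS_normal_iff: "GLS_normal D l r e x \<longleftrightarrow> equidistributed (\<lambda>n. (GLS_map D l r e ^^ n) x)"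
  by (simp add: GLS_normal_def equidistributed_def freq_def[abs_def])

lemma measure_unit_interval:
  fixes J :: "real set"
  assumes J: "J \<subseteq> {0..1}" and AB: "{A<..<B} \<subseteq> J" "J \<subseteq> {A..B}" "A \<le> B"
  shows "measure (lebesgue_on {0..1}) J = B - A"
proof -
  have "J - {A<..<B} \<subseteq> {A, B}" using AB by auto
  then have "finite (J - {A<..<B})" by (rule finite_subset) simp
  then have "J - {A<..<B} \<in> sets borel" by (intro borel_closed finite_imp_closed)
  then have "{A<..<B} \<union> (J - {A<..<B}) \<in> sets borel" by (intro sets.Un) auto
  also have "{A<..<B} \<union> (J - {A<..<B}) = J" using AB by auto
  finally have m: "J \<in> sets lebesgue" by (simp add: sets_completionI_sets)
  have f: "J \<in> lmeasurable" using m J bounded_subset[OF bounded_closed_interval J]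
    by (intro bounded_set_imp_lmeasurable) auto
  have "B - A = measure lebesgue {A<..<B}" using AB by simp
  also have "\<dots> \<le> measure lebesgue J" using f AB by (intro measure_mono_fmeasurable) auto
  finally have "B - A \<le> measure lebesgue J" .
  moreover have "measure lebesgue J \<le> measure lebesgue {A..B}"
    using m AB by (intro measure_mono_fmeasurable) auto
  ultimately show ?thesis using AB J by (simp add: measure_restrict_space)
qed

lemma interval_endpoints:
  fixes J :: "real set"
  assumes "is_interval J" "J \<subseteq> {0..1}" "J \<noteq> {}"
  obtains A B where "{A<..<B} \<subseteq> J" "J \<subseteq> {A..B}" "A \<le> B" "0 \<le> A" "B \<le> 1"
proof
  have bdd: "bdd_below J" "bdd_above J"
    using assms(2) by (meson bdd_below_Icc bdd_below_mono bdd_above_Icc bdd_above_mono)+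
  show "{Inf J<..<Sup J} \<subseteq> J"
  proof
    fix x assume "x \<in> {Inf J<..<Sup J}"
    then obtain u v where "u \<in> J" "u < x" "v \<in> J" "x < v"
      using cInf_less_iff[OF assms(3) bdd(1)] less_cSup_iff[OF assms(3) bdd(2)] by auto
    then show "x \<in> J" using assms(1) unfolding is_interval_1 by (meson less_imp_le)
  qed
  show "J \<subseteq> {Inf J..Sup J}" using bdd by (auto intro: cInf_lower cSup_upper)
  show "Inf J \<le> Sup J" using assms(3) bdd by (intro cInf_le_cSup)
  show "0 \<le> Inf J" using assms by (intro cInf_greatest) auto
  show "Sup J \<le> 1" using assms by (intro cSup_least) auto
qed

text \<open>Lower bounds on closed intervals suffice, because an upper bound on an interval comes from
  lower bounds on the two components of its complement.\<close>

lemma equidistributed_iff: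
  assumes y: "\<And>n. y n \<in> {0..1}"
  shows "equidistributed y \<longleftrightarrow>
    (\<forall>a\<in>\<rat>. \<forall>b\<in>\<rat>. \<forall>k. 0 \<le> a \<and> a < b \<and> b \<le> 1 \<longrightarrow>
       (\<forall>\<^sub>F N in sequentially. b - a - 1 / real (Suc k) \<le> freq (\<lambda>n. y n \<in> {a..b}) N))"
    (is "_ \<longleftrightarrow> ?R")
proof
  assume E: "equidistributed y"
  show ?R
  proof (intro ballI allI impI)
    fix a b :: real and k :: nat assume ab: "0 \<le> a \<and> a < b \<and> b \<le> 1"
    have "freq (\<lambda>n. y n \<in> {a..b}) \<longlonglongrightarrow> measure (lebesgue_on {0..1}) {a..b}"
      using E ab unfolding equidistributed_def by (metis atLeastatMost_subset_iff is_interval_cc)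
    also have "measure (lebesgue_on {0..1}) {a..b} = b - a"
      using ab by (intro measure_unit_interval) auto
    finally have "\<forall>\<^sub>F N in sequentially. b - a - 1 / real (Suc k) < freq (\<lambda>n. y n \<in> {a..b}) N"
      by (rule order_tendstoD) auto
    then show "\<forall>\<^sub>F N in sequentially. b - a - 1 / real (Suc k) \<le> freq (\<lambda>n. y n \<in> {a..b}) N"
      by eventually_elim simp
  qed
next
  assume R: ?R
  \<comment> \<open>Moving to rational endpoints inside costs at most \<open>\<epsilon> / 3\<close>
    at each end; \<open>1 / real (Suc k)\<close> costs the last third.\<close>
  have low: "\<forall>\<^sub>F N in sequentially. B - A - \<epsilon> \<le> freq (\<lambda>n. y n \<in> S) N"
    if AB: "0 \<le> A" "B \<le> 1" "{A<..<B} \<subseteq> S" "0 < \<epsilon>" for A B \<epsilon> S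
  proof (cases "B - A < \<epsilon>")
    case True
    then have "B - A - \<epsilon> \<le> freq (\<lambda>n. y n \<in> S) N" for N
      using freq_nonneg[of "\<lambda>n. y n \<in> S" N] by linarith
    then show ?thesis by simp
  next
    case False
    then obtain a b where ab: "a \<in> \<rat>" "A < a" "a < A + \<epsilon> / 3" "b \<in> \<rat>" "B - \<epsilon> / 3 < b" "b < B"
      using AB Rats_dense_in_real[of A "A + \<epsilon> / 3"] Rats_dense_in_real[of "B - \<epsilon> / 3" B] by auto
    obtain k where k: "1 / real (Suc k) < \<epsilon> / 3"
      using AB nat_approx_posE[of "\<epsilon> / 3"] by auto
    have "0 \<le> a \<and> a < b \<and> b \<le> 1" using ab AB False by auto
    then have "\<forall>\<^sub>F N in sequentially. b - a - 1 / real (Suc k) \<le> freq (\<lambda>n. y n \<in> {a..b}) N"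
      using R ab by blast
    then show ?thesis
    proof eventually_elim
      case (elim N)
      have "B - A - \<epsilon> \<le> b - a - 1 / real (Suc k)" using ab k by linarith
      also note elim
      also have "freq (\<lambda>n. y n \<in> {a..b}) N \<le> freq (\<lambda>n. y n \<in> S) N"
        using ab AB by (intro freq_mono) auto
      finally show ?case .
    qed
  qed
  show "equidistributed y"
    unfolding equidistributed_def
  proof (intro allI impI)
    fix J :: "real set" assume J: "is_interval J \<and> J \<subseteq> {0..1}"
    show "freq (\<lambda>n. y n \<in> J) \<longlonglongrightarrow> measure (lebesgue_on {0..1}) J"
    proof (cases "J = {}")
      case False
      with J obtain A B where AB: "{A<..<B} \<subseteq> J" "J \<subseteq> {A..B}" "A \<le> B" "0 \<le> A" "B \<le> 1"
        using interval_endpoints by blast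
      have "freq (\<lambda>n. y n \<in> J) \<longlonglongrightarrow> B - A"
      proof (rule order_tendstoI)
        fix u assume u: "u < B - A"
        have "\<forall>\<^sub>F N in sequentially. B - A - (B - A - u) / 2 \<le> freq (\<lambda>n. y n \<in> J) N"
          using AB u by (intro low) auto
        then show "\<forall>\<^sub>F N in sequentially. u < freq (\<lambda>n. y n \<in> J) N"
          by eventually_elim (use u in argo)
      next
        fix u assume u: "B - A < u"
        \<comment> \<open>Two deficits of \<open>\<epsilon>\<close> yield the upper bound
          \<open>B - A + 2 * \<epsilon>\<close>, which is below \<open>u\<close>.\<close>
        define \<epsilon> where "\<epsilon> = (u - (B - A)) / 3"
        have \<epsilon>: "0 < \<epsilon>" using u by (simp add: \<epsilon>_def)
        have "\<forall>\<^sub>F N in sequentially. A - 0 - \<epsilon> \<le> freq (\<lambda>n. y n \<in> {0<..<A}) N"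
             "\<forall>\<^sub>F N in sequentially. 1 - B - \<epsilon> \<le> freq (\<lambda>n. y n \<in> {B<..<1}) N"
          using AB \<epsilon> by (intro low; auto)+
        then show "\<forall>\<^sub>F N in sequentially. freq (\<lambda>n. y n \<in> J) N < u"
        proof eventually_elim
          case (elim N)
          have 1: "freq (\<lambda>n. y n \<in> J) N + freq (\<lambda>n. y n \<in> {0<..<A} \<union> {B<..<1}) N \<le> 1"
            using AB by (intro freq_disjoint_le) auto
          have 2: "freq (\<lambda>n. y n \<in> {0<..<A} \<union> {B<..<1}) N =
              freq (\<lambda>n. y n \<in> {0<..<A}) N + freq (\<lambda>n. y n \<in> {B<..<1}) N"
            unfolding freq_sum add_divide_distrib[symmetric] sum.distrib[symmetric]
            using AB by (intro arg_cong2[of _ _ _ _ "(/)"] sum.cong) (auto simp: of_bool_def)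
          show ?case using 1 2 elim \<epsilon> unfolding \<epsilon>_def by argo
        qed
      qed
      then show ?thesis using AB J by (simp add: measure_unit_interval)
    qed (simp add: freq_def[abs_def])
  qed
qed

text \<open>The open unit interval has measure 1 but is visited only finitely often.\<close>

lemma not_equidistributed_if_endpoints:
  assumes "\<And>n. m \<le> n \<Longrightarrow> y n \<in> {0, 1}"
  shows "\<not> equidistributed y"
proof
  let ?J = "{0<..<1::real}"
  assume "equidistributed y"
  then have "freq (\<lambda>n. y n \<in> ?J) \<longlonglongrightarrow> measure (lebesgue_on {0..1}) ?J"
    unfolding equidistributed_def by (metis greaterThanLessThan_subseteq_atLeastAtMost_iff is_interval_oo order_refl)
  moreover have "measure (lebesgue_on {0..1}) ?J = 1 - 0"
    by (rule measure_unit_interval) auto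
  moreover have "freq (\<lambda>n. y n \<in> ?J) \<longlonglongrightarrow> 0"
  proof (rule freq_eventually_zero)
    fix n assume "m \<le> n"
    then have "y n = 0 \<or> y n = 1" using assms[of n] by simp
    then show "y n \<notin> ?J" by auto
  qed
  ultimately have "(0::real) = 1 - 0" by (metis LIMSEQ_unique)
  then show False by simp
qed

section \<open>The third Borel level\<close>

lemma bold_Sigma_2: "bold_Sigma X 2 = {A. fsigma_in X A}"
proof -
  have "bold_Pi X (Suc 0) = {C. closedin X C}"
  proof (intro set_eqI iffI CollectI)
    fix C assume "C \<in> {C. closedin X C}"
    then have "openin X (topspace X - C)" "C = topspace X - (topspace X - C)"
      using closedin_subset by (auto simp: closedin_def)
    then show "C \<in> bold_Pi X (Suc 0)" by (auto simp: bold_Pi_def)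
  qed (auto simp: bold_Pi_def)
  then show ?thesis
    unfolding numeral_2_eq_2 bold_Sigma_Suc_Suc
    by (auto simp: fsigma_in_def union_of_def)
qed

lemma bold_Pi_2: "bold_Pi X 2 = {A. gdelta_in X A}"
proof (intro set_eqI iffI CollectI)
  fix A assume "A \<in> {A. gdelta_in X A}"
  then have "fsigma_in X (topspace X - A)" "A = topspace X - (topspace X - A)"
    using gdelta_in_subset by (auto simp: gdelta_in_fsigma_in)
  then show "A \<in> bold_Pi X 2" by (auto simp: bold_Pi_def bold_Sigma_2)
next
  fix A assume "A \<in> bold_Pi X 2"
  then show "gdelta_in X A"
    by (auto simp: bold_Pi_def bold_Sigma_2 fsigma_in_gdelta_in)
qed

lemma bold_Sigma_3: "bold_Sigma X 3 = {\<Union>F | F. countable F \<and> (\<forall>A\<in>F. gdelta_in X A)}"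
proof -
  have "bold_Sigma X 3 = {\<Union>F | F. countable F \<and> F \<subseteq> bold_Pi X 2}"
    unfolding numeral_3_eq_3 numeral_2_eq_2 bold_Sigma_Suc_Suc ..
  then show ?thesis by (simp add: bold_Pi_2 subset_iff Ball_def)
qed

section \<open>Baire space and fusion\<close>

text \<open>This is openness in the product of discrete spaces, expressed through its basic
  sets.\<close>

definition prefix_open :: "(nat \<Rightarrow> 'a) set \<Rightarrow> bool" where
  "prefix_open U \<longleftrightarrow> (\<forall>a\<in>U. \<exists>n. \<forall>b. (\<forall>i<n. b i = a i) \<longrightarrow> b \<in> U)"

text \<open>The diagonal \<open>s (Suc i) i\<close> is the limit: \<open>i < n (Suc i)\<close>
  because \<open>n\<close> is strictly increasing, so position \<open>i\<close> no longer changes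
  from stage \<open>Suc i\<close> on.\<close>

lemma fusion_limit:
  fixes s :: "nat \<Rightarrow> nat \<Rightarrow> 'a" and n :: "nat \<Rightarrow> nat"
  assumes n: "\<And>j. n j < n (Suc j)" and s: "\<And>j i. i < n j \<Longrightarrow> s (Suc j) i = s j i"
  obtains c where "\<And>j i. i < n j \<Longrightarrow> c i = s j i"
proof
  fix j i assume i: "i < n j"
  have sm: "strict_mono n" using n by (rule strict_mono_Suc_iff[THEN iffD2, rule_format])
  have stable: "s (j + m) i = s j i" if "i < n j" for j m
  proof (induction m)
    case (Suc m)
    have "n j \<le> n (j + m)" using sm by (simp add: strict_mono_less_eq)
    then show ?case using Suc s[of i "j + m"] that by simp
  qed simp
  have i': "i < n (Suc i)" using strict_mono_imp_increasing[OF sm, of "Suc i"] by simp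
  show "s (Suc i) i = s j i"
  proof (cases "Suc i \<le> j")
    case True
    then show ?thesis using stable[OF i', of "j - Suc i"] by simp
  next
    case False
    then show ?thesis using stable[OF i, of "Suc i - j"] by simp
  qed
qed

text \<open>The prefix carries no lower bound, so entries fixed earlier survive when the floor
  \<open>k\<close> is raised.\<close>

definition above :: "(nat \<Rightarrow> nat) \<Rightarrow> nat \<Rightarrow> nat \<Rightarrow> (nat \<Rightarrow> nat) set" where
  "above s n k = {b. (\<forall>i<n. b i = s i) \<and> (\<forall>i\<ge>n. k \<le> b i)}"

text \<open>Within \<^term>\<open>above s n k\<close> the sequences with infinitely many entries \<open>k\<close> are comeager,
  so a \<open>G\<^sub>\<delta>\<close> set of sequences tending to infinity is nowhere dense there.\<close>

lemma avoid_G_delta: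
  fixes U :: "nat \<Rightarrow> (nat \<Rightarrow> nat) set"
  assumes U: "\<And>j. prefix_open (U j)"
    and inf: "\<And>a. (\<And>j. a \<in> U j) \<Longrightarrow> filterlim a at_top sequentially"
  shows "\<exists>s' n'. n < n' \<and> s' \<in> above s n k \<and> above s' n' k \<inter> (\<Inter>j. U j) = {}"
proof (rule ccontr)
  assume none: "\<not> ?thesis"
  then have dense: "\<exists>b. b \<in> above s' n' k \<and> (\<forall>j. b \<in> U j)" if "n < n'" "s' \<in> above s n k" for s' n'
  proof -
    have "above s' n' k \<inter> (\<Inter>j. U j) \<noteq> {}" using none that by metis
    then show ?thesis by blast
  qed
  define P where "P = (\<lambda>j::nat. \<lambda>(s', n'). n < n' \<and> s' \<in> above s n k)"
  define Q where "Q = (\<lambda>j::nat. \<lambda>(s', n') (s'', n''). n' < n'' \<and> (\<forall>i<n'. s'' i = s' i) \<and>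
      (\<forall>b. (\<forall>i<n''. b i = s'' i) \<longrightarrow> b \<in> U j) \<and> (\<exists>i. n' \<le> i \<and> i < n'' \<and> s'' i = k))"
  have "\<exists>f. \<forall>j. P j (f j) \<and> Q j (f j) (f (Suc j))"
  proof (rule dependent_nat_choice)
    show "\<exists>x. P 0 x"
      by (auto simp: P_def above_def intro!: exI[of _ "\<lambda>i. if i < n then s i else k"] exI[of _ "Suc n"])
  next
    fix x j assume Px: "P j x"
    obtain s' n' where x: "x = (s', n')" by (cases x)
    with Px have P: "n < n'" "s' \<in> above s n k" by (auto simp: P_def)
    then obtain b where b: "b \<in> above s' n' k" "b \<in> U j" using dense by blast
    then obtain m where m: "\<And>c. \<forall>i<m. c i = b i \<Longrightarrow> c \<in> U j"
      using U unfolding prefix_open_def by blast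
    define n'' where "n'' = max m n'"
    \<comment> \<open>The altered position lies outside the \<open>m\<close> entries that secure
      \<open>U j\<close> and outside the old prefix, and the value \<open>k\<close> respects the
      floor.\<close>
    define s'' where "s'' = b(n'' := k)"
    have "P (Suc j) (s'', Suc n'')"
    proof -
      have "k \<le> b i" if "n \<le> i" for i
        using P b that by (cases "i < n'") (auto simp: above_def)
      then show ?thesis using P b by (auto simp: P_def above_def s''_def n''_def)
    qed
    moreover have "Q j x (s'', Suc n'')"
      using b m by (auto simp: x Q_def above_def s''_def n''_def intro!: exI[of _ "max m n'"])
    ultimately show "\<exists>y. P (Suc j) y \<and> Q j x y" by blast
  qed
  then obtain f where f: "\<And>j. P j (f j)" "\<And>j. Q j (f j) (f (Suc j))" by blast
  have n: "snd (f j) < snd (f (Suc j))" for j using f(2)[of j] by (auto simp: Q_def split_beta)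
  obtain c where c: "\<And>j i. i < snd (f j) \<Longrightarrow> c i = fst (f j) i"
  proof (rule fusion_limit[of "\<lambda>j. snd (f j)" "\<lambda>j. fst (f j)"])
    show "fst (f (Suc j)) i = fst (f j) i" if "i < snd (f j)" for j i
      using f(2)[of j] that by (auto simp: Q_def split_beta)
  qed (use n in auto)
  have "c \<in> U j" for j using f(2)[of j] c[of _ "Suc j"] by (auto simp: Q_def split_beta)
  then have "filterlim c at_top sequentially" by (rule inf)
  then obtain M where M: "\<And>i. M \<le> i \<Longrightarrow> Suc k \<le> c i"
    unfolding filterlim_at_top eventually_sequentially by blast
  have "strict_mono (\<lambda>j. snd (f j))" using n by (simp add: strict_mono_Suc_iff)
  then have "M \<le> snd (f M)" by (rule strict_mono_imp_increasing)
  moreover obtain i where "snd (f M) \<le> i" "i < snd (f (Suc M))" "fst (f (Suc M)) i = k"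
    using f(2)[of M] by (auto simp: Q_def split_beta)
  ultimately show False using M[of i] c[of i "Suc M"] by simp
qed

text \<open>Stage \<open>k\<close> leaves the \<open>k\<close>-th intersection for good, by
  \<open>avoid_G_delta\<close>, while all later entries stay at least \<open>k\<close>. The rising
  floor makes the limit diverge although it lies in none of the intersections.\<close>

proposition divergent_sequences_not_Sigma_3:
  assumes U: "\<And>k j. prefix_open (U k j)"
  shows "{a :: nat \<Rightarrow> nat. filterlim a at_top sequentially} \<noteq> (\<Union>k::nat. \<Inter>j::nat. U k j)"
proof
  assume eq: "{a :: nat \<Rightarrow> nat. filterlim a at_top sequentially} = (\<Union>k. \<Inter>j. U k j)"
  have step: "\<exists>s' n'. n < n' \<and> s' \<in> above s n k \<and> above s' n' k \<inter> (\<Inter>j. U k j) = {}" for s n k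
  proof (rule avoid_G_delta)
    show "filterlim a at_top sequentially" if "\<And>j. a \<in> U k j" for a
      using that eq by blast
  qed (rule U)
  define Q where "Q = (\<lambda>k::nat. \<lambda>(s, n) (s', n'). n < n' \<and> s' \<in> above s n k \<and>
      above s' n' k \<inter> (\<Inter>j. U k j) = {})"
  have "\<exists>f. \<forall>k. True \<and> Q k (f k) (f (Suc k))"
    by (rule dependent_nat_choice) (use step in \<open>auto simp: Q_def\<close>)
  then obtain f where f: "\<And>k. Q k (f k) (f (Suc k))" by blast
  have n: "snd (f j) < snd (f (Suc j))" for j using f[of j] by (auto simp: Q_def split_beta)
  obtain c where c: "\<And>j i. i < snd (f j) \<Longrightarrow> c i = fst (f j) i"
  proof (rule fusion_limit[of "\<lambda>j. snd (f j)" "\<lambda>j. fst (f j)"])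
    show "fst (f (Suc j)) i = fst (f j) i" if "i < snd (f j)" for j i
      using f[of j] that by (auto simp: Q_def above_def split_beta)
  qed (use n in auto)
  have sm: "strict_mono (\<lambda>j. snd (f j))" using n by (simp add: strict_mono_Suc_iff)
  have ge: "k \<le> c i" if "snd (f k) \<le> i" for k i
  proof -
    have "\<exists>m. i < snd (f m)"
      using strict_mono_imp_increasing[OF sm, of "Suc i"] by (intro exI[of _ "Suc i"]) simp
    then have "\<exists>m. i < snd (f (k + m))"
      by (metis le_add2 sm less_le_trans strict_mono_less_eq)
    \<comment> \<open>Minimality identifies \<open>k + m'\<close>, with \<open>m = Suc m'\<close>,
      as the stage that gave position \<open>i\<close> its final value; the floor was then
      \<open>k + m'\<close>.\<close>
    define m where "m = (LEAST m. i < snd (f (k + m)))"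
    have m: "i < snd (f (k + m))" unfolding m_def by (rule LeastI_ex) fact
    with that obtain m' where m': "m = Suc m'" by (cases m) auto
    then have "\<not> i < snd (f (k + m'))" using not_less_Least[of m' "\<lambda>m. i < snd (f (k + m))"] by (simp add: m_def)
    then have "k + m' \<le> fst (f (Suc (k + m'))) i"
      using f[of "k + m'"] by (auto simp: Q_def above_def split_beta)
    then show ?thesis using c[of i "k + m"] m m' by simp
  qed
  have "c \<in> above (fst (f (Suc k))) (snd (f (Suc k))) k" for k
    using c[of _ "Suc k"] ge[of "Suc k"] by (auto simp: above_def intro: Suc_leD)
  then have "c \<notin> (\<Inter>j. U k j)" for k
    using f[of k] by (auto simp: Q_def split_beta)
  moreover have "filterlim c at_top sequentially"
    unfolding filterlim_at_top eventually_sequentially using ge by blast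
  ultimately show False using eq by blast
qed

section \<open>Digit sequences with prescribed word frequencies\<close>

lemma has_sum_finite_sum:
  fixes f :: "'i \<Rightarrow> 'a \<Rightarrow> real"
  assumes "finite S" "\<And>i. i \<in> S \<Longrightarrow> (f i has_sum c i) A"
  shows "((\<lambda>x. \<Sum>i\<in>S. f i x) has_sum (\<Sum>i\<in>S. c i)) A"
  using assms by (induction S rule: finite_induct) (auto intro: has_sum_add)

text \<open>The digits are chosen so that the weighted sum of squares of the martingales
  \<open>\<Sum>n<N. 1[A\<^sub>j](1[d\<^sub>n = q\<^sub>j] - p(q\<^sub>j))\<close> grows by at most 1 in each step, as it does on average
  under the law \<open>p\<close>.\<close>

lemma greedy_sequence:
  fixes p :: "nat \<Rightarrow> real" and A :: "nat \<Rightarrow> nat list \<Rightarrow> bool" and q :: "nat \<Rightarrow> nat"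
  assumes p: "\<And>d. d \<in> D \<Longrightarrow> 0 \<le> p d" "(p has_sum 1) D" and q: "\<And>j. q j \<in> D"
  obtains d where "\<And>n. d n \<in> D"
    "\<And>j. (\<lambda>N. (\<Sum>n<N. if A j (map d [0..<n]) then of_bool (d n = q j) - p (q j) else 0) / real N)
            \<longlonglongrightarrow> 0"
proof -
  \<comment> \<open>Bet \<open>j\<close> starts only at time \<open>j\<close>, so finitely many
    martingales are active at a time and \<open>\<Phi>\<close> is a finite sum.\<close>
  define I where "I = (\<lambda>j h x. if j \<le> length h \<and> A j h then of_bool (x = q j) - p (q j) else 0)"
  define M where "M = (\<lambda>j h. \<Sum>n<length h. I j (take n h) (h ! n))"
  \<comment> \<open>Weights of total below 1 keep the weighted squared increments at most 1 per
    step. As each weight is positive, \<open>\<Phi>\<close> at most \<open>N\<close> makes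
    \<open>M j\<close> of order \<open>sqrt N\<close> for fixed \<open>j\<close>.\<close>
  define c :: "nat \<Rightarrow> real" where "c = (\<lambda>j. (1/2) ^ Suc j)"
  define \<Phi> where "\<Phi> = (\<lambda>h. \<Sum>j\<le>length h. c j * (M j h)\<^sup>2)"
  have c: "0 < c j" for j by (simp add: c_def)
  have c_sum: "(\<Sum>j\<le>n. c j) \<le> 1" for n
  proof -
    have "(\<Sum>j\<le>n. c j) = 1 - (1/2) ^ Suc n" by (induction n) (auto simp: c_def)
    then show ?thesis by simp
  qed
  have pq: "0 \<le> p (q j)" "p (q j) \<le> 1" for j
  proof -
    show "0 \<le> p (q j)" using p q by blast
    have "(p has_sum p (q j)) {q j}" by (simp add: has_sum_finiteI)
    then show "p (q j) \<le> 1"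
      by (rule has_sum_mono_neutral[OF _ p(2)]) (use p q in auto)
  qed
  have I_le: "\<bar>I j h x\<bar> \<le> 1" for j h x
    using pq[of j] by (auto simp: I_def)
  have M_snoc: "M j (h @ [x]) = M j h + I j h x" for j h x
    unfolding M_def by (simp add: nth_append)
  have I_mean: "((\<lambda>x. p x * I j h x) has_sum 0) D" for j h
  proof (cases "j \<le> length h \<and> A j h")
    case True
    have "((\<lambda>x. p x * of_bool (x = q j)) has_sum p (q j)) D"
      using has_sum_finite_neutralI[where B = "{q j}" and A = D and f = "\<lambda>x. p x * of_bool (x = q j)"] q by auto
    moreover have "((\<lambda>x. p x * - p (q j)) has_sum 1 * - p (q j)) D"
      using p(2) by (rule has_sum_cmult_left)
    ultimately have "((\<lambda>x. p x * of_bool (x = q j) + p x * - p (q j)) has_sum p (q j) + 1 * - p (q j)) D"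
      by (rule has_sum_add)
    then show ?thesis using True by (simp add: I_def right_diff_distrib)
  qed (auto simp: I_def)
  have step: "\<exists>x\<in>D. \<Phi> (h @ [x]) \<le> \<Phi> h + 1" for h
  proof -
    \<comment> \<open>Half the cross term in the expansion of the squares at \<open>h @ [x]\<close>.
      Its mean under \<open>p\<close> is 0, so some digit makes it nonpositive.\<close>
    define G where "G = (\<lambda>x. \<Sum>j\<le>length h. c j * M j h * I j h x)"
    have "((\<lambda>x. \<Sum>j\<le>length h. (c j * M j h) * (p x * I j h x)) has_sum (\<Sum>j\<le>length h. (c j * M j h) * 0)) D"
      by (intro has_sum_finite_sum has_sum_cmult_right I_mean) auto
    also have "(\<lambda>x. \<Sum>j\<le>length h. (c j * M j h) * (p x * I j h x)) = (\<lambda>x. p x * G x)"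
      by (simp add: G_def sum_distrib_left mult_ac)
    finally have G0: "((\<lambda>x. p x * G x) has_sum 0) D" by simp
    have "\<exists>x\<in>D. G x \<le> 0"
    proof (rule ccontr)
      assume "\<not> (\<exists>x\<in>D. G x \<le> 0)"
      then have pos: "0 < G x" if "x \<in> D" for x using that by force
      have "p x * G x = 0" if "x \<in> D" for x
        using nonneg_has_sum_le_0D[OF G0 _ _ that] p pos by (simp add: less_imp_le)
      then have "p x = 0" if "x \<in> D" for x using pos[OF that] that by fastforce
      then have "(p has_sum 0) D" by (intro has_sum_0)
      then show False using has_sum_unique[OF p(2)] by fastforce
    qed
    then obtain x where x: "x \<in> D" "G x \<le> 0" by blast
    let ?n = "length h"
    \<comment> \<open>\<open>\<Phi> (h @ [x])\<close> has one summand more than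
      \<open>\<Phi> h\<close>; its bet has not started, so it vanishes.\<close>
    have "M (Suc ?n) h = 0" "I (Suc ?n) h x = 0" by (auto simp: M_def I_def)
    then have "\<Phi> (h @ [x]) = (\<Sum>j\<le>?n. c j * (M j h + I j h x)\<^sup>2)"
      by (simp add: \<Phi>_def M_snoc)
    also have "\<dots> = \<Phi> h + 2 * G x + (\<Sum>j\<le>?n. c j * (I j h x)\<^sup>2)"
      by (simp add: \<Phi>_def G_def power2_sum algebra_simps sum.distrib sum_distrib_left)
    also have "(\<Sum>j\<le>?n. c j * (I j h x)\<^sup>2) \<le> (\<Sum>j\<le>?n. c j)"
      using c I_le by (intro sum_mono mult_left_le) (auto simp: abs_square_le_1 less_imp_le)
    also have "\<dots> \<le> 1" by (rule c_sum)
    finally show ?thesis using x by force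
  qed
  have "\<exists>H. \<forall>n. (length (H n) = n \<and> \<Phi> (H n) \<le> real n) \<and> (\<exists>x\<in>D. H (Suc n) = H n @ [x])"
  proof (rule dependent_nat_choice)
    show "\<exists>h. length h = 0 \<and> \<Phi> h \<le> real 0" by (auto simp: \<Phi>_def M_def)
  next
    fix h n assume h: "length h = n \<and> \<Phi> h \<le> real n"
    obtain x where "x \<in> D" "\<Phi> (h @ [x]) \<le> \<Phi> h + 1" using step by blast
    with h show "\<exists>h'. (length h' = Suc n \<and> \<Phi> h' \<le> real (Suc n)) \<and> (\<exists>x\<in>D. h' = h @ [x])"
      by (intro exI[of _ "h @ [x]"]) auto
  qed
  then obtain H where H: "\<And>n. length (H n) = n" "\<And>n. \<Phi> (H n) \<le> real n"
    "\<And>n. \<exists>x\<in>D. H (Suc n) = H n @ [x]" by blast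
  then obtain d where d: "\<And>n. d n \<in> D" "\<And>n. H (Suc n) = H n @ [d n]" by metis
  have H_map: "H n = map d [0..<n]" for n
    by (induction n) (use H(1)[of 0] d in auto)
  have M_bound: "\<bar>M j (H N)\<bar> \<le> sqrt (real N / c j)" if "j \<le> N" for j N
  proof -
    have "c j * (M j (H N))\<^sup>2 \<le> (\<Sum>j\<le>N. c j * (M j (H N))\<^sup>2)"
      using that c by (intro member_le_sum) (auto simp: less_imp_le)
    also have "\<dots> \<le> real N" using H(2)[of N] H(1)[of N] by (simp add: \<Phi>_def)
    finally have "(M j (H N))\<^sup>2 \<le> real N / c j" using c[of j] by (simp add: field_simps)
    then show ?thesis by (rule real_le_rsqrt[of "\<bar>M j (H N)\<bar>", simplified])
  qed
  have "(\<lambda>N. (\<Sum>n<N. if A j (map d [0..<n]) then of_bool (d n = q j) - p (q j) else 0) / real N)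
          \<longlonglongrightarrow> 0" (is "(\<lambda>N. ?S N / _) \<longlonglongrightarrow> 0") for j
  proof (rule Lim_null_comparison)
    \<comment> \<open>The delayed start of bet \<open>j\<close> affects at most \<open>j\<close>
      terms, which is negligible after division by \<open>N\<close>.\<close>
    have "\<bar>?S N - M j (H N)\<bar> \<le> real j" for N
    proof -
      have "M j (H N) = (\<Sum>n<N. I j (map d [0..<n]) (d n))"
        by (simp add: M_def H_map take_map)
      then have "?S N - M j (H N) = (\<Sum>n<N. (if A j (map d [0..<n]) then of_bool (d n = q j) - p (q j) else 0)
          - I j (map d [0..<n]) (d n))"
        by (simp only: sum_subtractf)
      also have "\<bar>\<dots>\<bar> \<le> (\<Sum>n<N. of_bool (n < j))"
        using pq[of j] by (intro order_trans[OF sum_abs] sum_mono) (auto simp: I_def)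
      also have "\<dots> = real (card ({..<N} \<inter> {n. n < j}))" by (subst sum_of_bool_eq) auto
      also have "\<dots> \<le> real (card {..<j})" by (intro of_nat_mono card_mono) auto
      finally show ?thesis by simp
    qed
    then have "\<bar>?S N\<bar> \<le> sqrt (real N / c j) + real j" if "j \<le> N" for N
      using M_bound[OF that] by (smt (verit))
    then show "\<forall>\<^sub>F N in sequentially. norm (?S N / real N) \<le> (sqrt (real N / c j) + real j) / real N"
      unfolding eventually_sequentially by (auto intro!: exI[of _ j] divide_right_mono)
    have "(\<lambda>N. sqrt (1 / c j) * (1 / sqrt (real N)) + real j / real N) \<longlonglongrightarrow> sqrt (1 / c j) * 0 + 0"
      by (intro tendsto_intros lim_const_over_n
          tendsto_divide_0[OF tendsto_const] filterlim_at_top_imp_at_infinity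
          filterlim_compose[OF sqrt_at_top filterlim_real_sequentially])
    moreover have "sqrt (real N / c j) / real N = sqrt (1 / c j) * (1 / sqrt (real N))" for N
    proof -
      have "sqrt (real N / c j) / real N = sqrt (1 / c j) * (sqrt (real N) / real N)"
        by (simp add: real_sqrt_divide)
      then show ?thesis by (simp add: sqrt_divide_self_eq inverse_eq_divide)
    qed
    ultimately show "(\<lambda>N. (sqrt (real N / c j) + real j) / real N) \<longlonglongrightarrow> 0"
      by (simp add: add_divide_distrib)
  qed
  with d(1) that show ?thesis by blast
qed

section \<open>Word frequencies\<close>

definition occurs :: "(nat \<Rightarrow> nat) \<Rightarrow> nat list \<Rightarrow> nat \<Rightarrow> bool" where
  "occurs d w n \<longleftrightarrow> (\<forall>i<length w. d (n + i) = w ! i)"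

lemma occurs_iff_map: "occurs d w n \<longleftrightarrow> map d [n..<n + length w] = w"
  unfolding occurs_def list_eq_iff_nth_eq by simp

lemma occurs_snoc: "occurs d (w @ [a]) n \<longleftrightarrow> occurs d w n \<and> d (n + length w) = a"
  by (simp add: occurs_iff_map)

text \<open>The greedy sequence is applied to all pairs of a word \<open>w\<close> and a digit
  \<open>a\<close>, betting on \<open>a\<close> whenever the history ends in \<open>w\<close>. The
  balance compares the frequency of \<open>w @ [a]\<close> with \<open>p a\<close> times that of
  \<open>w\<close>, and the product formula follows by induction on the word.\<close>

lemma exists_word_normal:
  fixes p :: "nat \<Rightarrow> real"
  assumes p: "\<And>d. d \<in> D \<Longrightarrow> 0 \<le> p d" "(p has_sum 1) D"
  obtains d where "\<And>n. d n \<in> D"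
    "\<And>w. set w \<subseteq> D \<Longrightarrow> freq (occurs d w) \<longlonglongrightarrow> prod_list (map p w)"
proof -
  have "D \<noteq> {}"
    using p(2) has_sum_unique[OF has_sum_empty, of p 1] by auto
  then obtain d0 where d0: "d0 \<in> D" by blast
  define wa :: "nat \<Rightarrow> nat list \<times> nat" where "wa = from_nat"
  \<comment> \<open>\<open>from_nat\<close> may decode a pair whose digit lies outside
    \<open>D\<close>; \<open>d0\<close> is the default for such indices.\<close>
  define q where "q = (\<lambda>j. if snd (wa j) \<in> D then snd (wa j) else d0)"
  define A where "A = (\<lambda>j h. \<exists>u. h = u @ fst (wa j))"
  have "\<And>j. q j \<in> D" using d0 by (simp add: q_def)
  then obtain d where d: "\<And>n. d n \<in> D"
    "\<And>j. (\<lambda>N. (\<Sum>n<N. if A j (map d [0..<n]) then of_bool (d n = q j) - p (q j) else 0) / real N)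
            \<longlonglongrightarrow> 0"
    using greedy_sequence[where A = A and q = q and p = p and D = D] p by blast
  have rec: "(\<lambda>N. freq (occurs d (w @ [a])) N - p a * freq (occurs d w) N) \<longlonglongrightarrow> 0" if "a \<in> D" for w a
  proof -
    define j where "j = to_nat (w, a)"
    have j: "wa j = (w, a)" "q j = a" using that by (auto simp: j_def wa_def q_def)
    let ?m = "length w"
    define t where "t = (\<lambda>n. if A j (map d [0..<n]) then of_bool (d n = q j) - p (q j) else 0 :: real)"
    have split: "[0..<n] = [0..<k] @ [k..<n]" if "k \<le> n" for k n
      using upt_add_eq_append[of 0 k "n - k"] that by simp
    have A: "A j (map d [0..<n]) \<longleftrightarrow> ?m \<le> n \<and> occurs d w (n - ?m)" for n
    proof
      assume "A j (map d [0..<n])"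
      then obtain u where u: "map d [0..<n] = u @ w" by (auto simp: A_def j)
      then have n: "n = length u + ?m" by (metis length_append length_map length_upt diff_zero)
      then have "map d [0..<n] = map d [0..<length u] @ map d [length u..<n]"
        using split[of "length u" n] by (metis le_add1 map_append)
      then have "map d [length u..<n] = w" using u by simp
      then show "?m \<le> n \<and> occurs d w (n - ?m)" using n by (simp add: occurs_iff_map)
    next
      assume *: "?m \<le> n \<and> occurs d w (n - ?m)"
      then have "map d [0..<n] = map d [0..<n - ?m] @ map d [n - ?m..<n]"
        using split[of "n - ?m" n] by (metis diff_le_self map_append)
      also have "map d [n - ?m..<n] = w" 
        using * by (metis le_add_diff_inverse2 occurs_iff_map)
      finally show "A j (map d [0..<n])" by (auto simp: A_def j)
    qed
    \<comment> \<open>A bet is placed at the end of an occurrence of \<open>w\<close>, while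
      \<open>occurs\<close> refers to its start. The shift by \<open>?m\<close> reconciles the two;
      no bet is placed before time \<open>?m\<close>.\<close>
    have *: "(\<Sum>n<N + ?m. t n) = (\<Sum>n<N. of_bool (occurs d (w @ [a]) n) - p a * of_bool (occurs d w n))" for N
    proof -
      have "(\<Sum>n<N + ?m. t n) = (\<Sum>n<?m. t n) + (\<Sum>n<N. t (n + ?m))"
        by (induction N) auto
      also have "(\<Sum>n<?m. t n) = 0" by (intro sum.neutral) (auto simp: t_def A)
      also have "(\<Sum>n<N. t (n + ?m)) = (\<Sum>n<N. of_bool (occurs d (w @ [a]) n) - p a * of_bool (occurs d w n))"
        by (intro sum.cong) (auto simp: t_def A occurs_snoc j)
      finally show ?thesis by simp
    qed
    have eq: "freq (occurs d (w @ [a])) N - p a * freq (occurs d w) N =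
        (\<Sum>n<N + ?m. t n) / real (N + ?m) * (1 + real ?m / real N)" if "0 < N" for N
    proof -
      have "(1 + real ?m / real N) = real (N + ?m) / real N" using that by (simp add: add_divide_distrib)
      moreover have "real (N + ?m) \<noteq> 0" using that by linarith
      ultimately have "(\<Sum>n<N + ?m. t n) / real (N + ?m) * (1 + real ?m / real N) = (\<Sum>n<N + ?m. t n) / real N"
        by simp
      then show ?thesis
        using * by (simp add: freq_sum sum_subtractf sum_distrib_left diff_divide_distrib)
    qed
    have "(\<lambda>N. (\<Sum>n<N + ?m. t n) / real (N + ?m) * (1 + real ?m / real N)) \<longlonglongrightarrow> 0 * (1 + 0)"
      using LIMSEQ_ignore_initial_segment[OF d(2)[of j], of ?m]
      by (intro tendsto_intros lim_const_over_n) (simp add: t_def)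
    moreover have "\<forall>\<^sub>F N in sequentially. (\<Sum>n<N + ?m. t n) / real (N + ?m) * (1 + real ?m / real N)
        = freq (occurs d (w @ [a])) N - p a * freq (occurs d w) N"
      using eventually_gt_at_top[of 0] by eventually_elim (simp add: eq)
    ultimately show ?thesis by (simp add: filterlim_cong[OF refl refl])
  qed
  have "freq (occurs d w) \<longlonglongrightarrow> prod_list (map p w)" if "set w \<subseteq> D" for w
    using that
  proof (induction w rule: rev_induct)
    case Nil
    have "\<forall>\<^sub>F N in sequentially. freq (occurs d []) N = 1"
      using eventually_gt_at_top[of 0] by eventually_elim (simp add: freq_def occurs_def)
    then show ?case by (simp add: tendsto_eventually)
  next
    case (snoc a w)
    then have "(\<lambda>N. (freq (occurs d (w @ [a])) N - p a * freq (occurs d w) N) + p a * freq (occurs d w) N)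
        \<longlonglongrightarrow> 0 + p a * prod_list (map p w)"
      by (intro tendsto_add tendsto_mult_left rec) auto
    then show ?case by (simp add: mult.commute)
  qed
  with d(1) that show ?thesis by blast
qed

lemma freq_shift_zero:
  assumes "freq P \<longlonglongrightarrow> 0"
  shows "freq (\<lambda>n. P (n + i)) \<longlonglongrightarrow> 0"
proof (rule tendsto_sandwich[of "\<lambda>N. 0" _ _ "\<lambda>N. freq P N + real i / real N"])
  have "(\<Sum>n<N. of_bool (P (n + i))) \<le> (\<Sum>n<N. of_bool (P n)) + real i" for N
  proof -
    have "(\<Sum>n<N. of_bool (P (n + i))) = (\<Sum>n\<in>{0 + i..<N + i}. of_bool (P n) :: real)"
      unfolding sum.shift_bounds_nat_ivl by (simp add: lessThan_atLeast0)
    also have "\<dots> \<le> (\<Sum>n<N + i. of_bool (P n))"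
      by (intro sum_mono2) auto
    also have "\<dots> \<le> (\<Sum>n<N. of_bool (P n)) + real i"
      by (induction i) auto
    finally show ?thesis .
  qed
  then show "\<forall>\<^sub>F N in sequentially. freq (\<lambda>n. P (n + i)) N \<le> freq P N + real i / real N"
    unfolding freq_sum add_divide_distrib[symmetric]
    by (intro always_eventually allI divide_right_mono) auto
  show "(\<lambda>N. freq P N + real i / real N) \<longlonglongrightarrow> 0"
    using tendsto_add[OF assms lim_const_over_n[of "real i"]] by simp
qed (auto simp: freq_nonneg)

text \<open>An occurrence is created or destroyed only by a disagreement at one of the
  \<open>length w\<close> positions that it covers, and each shifted set of disagreements has
  frequency 0.\<close>

lemma freq_occurs_perturb:
  assumes "freq (\<lambda>n. d n \<noteq> d' n) \<longlonglongrightarrow> 0" and "freq (occurs d w) \<longlonglongrightarrow> x"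
  shows "freq (occurs d' w) \<longlonglongrightarrow> x"
proof -
  have "(\<lambda>N. freq (occurs d' w) N - freq (occurs d w) N) \<longlonglongrightarrow> 0"
  proof (rule Lim_null_comparison)
    have *: "\<bar>of_bool (occurs d' w n) - of_bool (occurs d w n)\<bar>
        \<le> (\<Sum>i<length w. of_bool (d (n + i) \<noteq> d' (n + i)) :: real)" for n
    proof (cases "\<exists>i<length w. d (n + i) \<noteq> d' (n + i)")
      case True
      then obtain i where i: "i < length w" "d (n + i) \<noteq> d' (n + i)" by blast
      then have "of_bool (d (n + i) \<noteq> d' (n + i)) \<le> (\<Sum>i<length w. of_bool (d (n + i) \<noteq> d' (n + i)) :: real)"
        by (intro member_le_sum) auto
      with i show ?thesis by (simp add: of_bool_def split: if_splits)
    next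
      case False
      then have "occurs d' w n \<longleftrightarrow> occurs d w n" by (simp add: occurs_def)
      then show ?thesis by (simp add: sum_nonneg)
    qed
    have "\<bar>freq (occurs d' w) N - freq (occurs d w) N\<bar>
        \<le> (\<Sum>i<length w. freq (\<lambda>n. d (n + i) \<noteq> d' (n + i)) N)" for N
    proof -
      have "\<bar>freq (occurs d' w) N - freq (occurs d w) N\<bar>
          = \<bar>\<Sum>n<N. of_bool (occurs d' w n) - of_bool (occurs d w n)\<bar> / real N"
        by (simp add: freq_sum sum_subtractf diff_divide_distrib[symmetric])
      also have "\<dots> \<le> (\<Sum>n<N. \<Sum>i<length w. of_bool (d (n + i) \<noteq> d' (n + i))) / real N"
        by (intro divide_right_mono order_trans[OF sum_abs] sum_mono *) auto
      also have "\<dots> = (\<Sum>i<length w. freq (\<lambda>n. d (n + i) \<noteq> d' (n + i)) N)"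
        unfolding freq_sum sum_divide_distrib[symmetric] by (subst sum.swap) simp
      finally show ?thesis .
    qed
    then show "\<forall>\<^sub>F N in sequentially. norm (freq (occurs d' w) N - freq (occurs d w) N)
        \<le> (\<Sum>i<length w. freq (\<lambda>n. d (n + i) \<noteq> d' (n + i)) N)" by simp
    show "(\<lambda>N. \<Sum>i<length w. freq (\<lambda>n. d (n + i) \<noteq> d' (n + i)) N) \<longlonglongrightarrow> 0"
      using freq_shift_zero[OF assms(1)] by (intro tendsto_null_sum)
  qed
  from tendsto_add[OF this assms(2)] show ?thesis by simp
qed

section \<open>Overwriting parts of dyadic blocks\<close>

text \<open>Block \<open>i\<close> is \<open>{2 ^ i..<2 ^ Suc i}\<close>; the value
  \<open>a i = 0\<close> marks all of it.\<close>

definition marked :: "(nat \<Rightarrow> nat) \<Rightarrow> nat set" where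
  "marked a = (\<Union>i. {2 ^ i..<2 ^ i + 2 ^ i div Suc (a i)})"

text \<open>Block \<open>i\<close> starts at \<open>2 ^ i\<close>, so blocks from \<open>m\<close>
  on cannot contain \<open>n\<close>. This locality will make the coded point depend continuously on
  \<open>a\<close>.\<close>

lemma marked_cong:
  assumes "\<And>i. i < m \<Longrightarrow> a i = b i" "n < 2 ^ m"
  shows "n \<in> marked a \<longleftrightarrow> n \<in> marked b"
proof -
  have "n \<in> {2 ^ i..<2 ^ i + 2 ^ i div Suc (a i)} \<longleftrightarrow> n \<in> {2 ^ i..<2 ^ i + 2 ^ i div Suc (b i)}" for i
  proof (cases "i < m")
    case False
    then have "(2::nat) ^ m \<le> 2 ^ i" by (intro power_increasing) auto
    then have "\<not> 2 ^ i \<le> n" using assms(2) by linarith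
    then show ?thesis by simp
  qed (simp add: assms(1))
  then show ?thesis by (simp add: marked_def)
qed

text \<open>Late blocks are marked in a proportion of at most \<open>1 / real (Suc K)\<close>, the
  blocks meeting \<open>{..<N}\<close> have total length below \<open>2 * N\<close>, and the early
  blocks contribute a bounded number of positions.\<close>

lemma freq_marked:
  assumes "filterlim a at_top sequentially"
  shows "freq (\<lambda>n. n \<in> marked a) \<longlonglongrightarrow> 0"
proof (rule order_tendstoI)
  fix \<epsilon> :: real assume "0 < \<epsilon>"
  obtain K where K: "1 / real (Suc K) < \<epsilon> / 4" using \<open>0 < \<epsilon>\<close> nat_approx_posE[of "\<epsilon> / 4"] by auto
  obtain i0 where i0: "\<And>i. i0 \<le> i \<Longrightarrow> K \<le> a i"
    using assms unfolding filterlim_at_top eventually_sequentially by blast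
  have le: "freq (\<lambda>n. n \<in> marked a) N \<le> 2 ^ i0 / real N + 2 / real (Suc K)" if "0 < N" for N
  proof -
    \<comment> \<open>Rounding \<open>N\<close> up to a power of 2 at most doubles it, hence
      \<open>\<epsilon> / 4\<close> in the choice of \<open>K\<close>.\<close>
    define k where "k = (LEAST k. N \<le> 2 ^ k)"
    have k: "N \<le> 2 ^ k" unfolding k_def by (rule LeastI[of _ N]) (simp add: less_imp_le)
    have "2 ^ k \<le> 2 * N"
    proof (cases k)
      case (Suc k')
      then have "\<not> N \<le> 2 ^ k'" using not_less_Least[of k' "\<lambda>k. N \<le> 2 ^ k"] by (simp add: k_def)
      then show ?thesis using Suc by simp
    qed (use that in simp)
    have "{n. n < N \<and> n \<in> marked a} \<subseteq> {..<2 ^ i0} \<union> (\<Union>i\<in>{i0..<k}. {2 ^ i..<2 ^ i + 2 ^ i div Suc (a i)})"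
    proof (intro subsetI)
      fix n assume "n \<in> {n. n < N \<and> n \<in> marked a}"
      then obtain i where i: "n < N" "n \<in> {2 ^ i..<2 ^ i + 2 ^ i div Suc (a i)}" by (auto simp: marked_def)
      show "n \<in> {..<2 ^ i0} \<union> (\<Union>i\<in>{i0..<k}. {2 ^ i..<2 ^ i + 2 ^ i div Suc (a i)})"
      proof (cases "i0 \<le> i")
        case True
        have "2 ^ i \<le> n" using i(2) by simp
        then have "(2::nat) ^ i < 2 ^ k" using i(1) k by linarith
        then have "i < k" by simp
        then show ?thesis using i True by auto
      next
        case False
        have "2 ^ i div Suc (a i) \<le> 2 ^ i" by (rule div_le_dividend)
        then have "n < 2 ^ i + 2 ^ i" using i(2) unfolding atLeastLessThan_iff by linarith
        also have "\<dots> = 2 ^ Suc i" by simp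
        also have "\<dots> \<le> 2 ^ i0" using False by (intro power_increasing) auto
        finally show ?thesis by simp
      qed
    qed
    then have "card {n. n < N \<and> n \<in> marked a} \<le>
        card ({..<2 ^ i0} \<union> (\<Union>i\<in>{i0..<k}. {2 ^ i..<2 ^ i + 2 ^ i div Suc (a i)}))"
      by (intro card_mono) auto
    also have "\<dots> \<le> 2 ^ i0 + (\<Sum>i\<in>{i0..<k}. 2 ^ i div Suc (a i))"
    proof -
      have "card (\<Union>i\<in>{i0..<k}. {2 ^ i..<2 ^ i + 2 ^ i div Suc (a i)})
          \<le> (\<Sum>i\<in>{i0..<k}. card {2 ^ i..<2 ^ i + 2 ^ i div Suc (a i)})"
        by (rule card_UN_le) simp
      also have "\<dots> = (\<Sum>i\<in>{i0..<k}. 2 ^ i div Suc (a i))" by simp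
      finally show ?thesis
        by (intro order_trans[OF card_Un_le] add_mono) simp
    qed
    finally have "real (card {n. n < N \<and> n \<in> marked a}) \<le> real (2 ^ i0 + (\<Sum>i\<in>{i0..<k}. 2 ^ i div Suc (a i)))"
      by (rule of_nat_mono)
    also have "\<dots> = 2 ^ i0 + (\<Sum>i\<in>{i0..<k}. real (2 ^ i div Suc (a i)))" by simp
    also have "(\<Sum>i\<in>{i0..<k}. real (2 ^ i div Suc (a i))) \<le> (\<Sum>i\<in>{i0..<k}. 2 ^ i / real (Suc K))"
    proof (intro sum_mono)
      fix i assume "i \<in> {i0..<k}"
      then have "K \<le> a i" using i0 by simp
      have "real (2 ^ i div Suc (a i)) \<le> real (2 ^ i) / real (Suc (a i))"
        by (rule of_nat_div_le_of_nat)
      also have "real (2 ^ i) / real (Suc (a i)) \<le> 2 ^ i / real (Suc K)"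
        using \<open>K \<le> a i\<close> by (auto intro!: divide_left_mono)
      finally show "real (2 ^ i div Suc (a i)) \<le> 2 ^ i / real (Suc K)" .
    qed
    also have "\<dots> \<le> (\<Sum>i<k. 2 ^ i / real (Suc K))" by (intro sum_mono2) auto
    also have "\<dots> = (2 ^ k - 1) / real (Suc K)"
      by (simp add: sum_divide_distrib[symmetric] geometric_sum)
    also have "\<dots> \<le> 2 * real N / real (Suc K)"
    proof (intro divide_right_mono)
      have "real (2 ^ k) \<le> real (2 * N)" using \<open>2 ^ k \<le> 2 * N\<close> by (rule of_nat_mono)
      then show "2 ^ k - 1 \<le> 2 * real N" by simp
    qed simp
    finally have "real (card {n. n < N \<and> n \<in> marked a}) \<le> 2 ^ i0 + 2 * real N / real (Suc K)" by simp
    then have "freq (\<lambda>n. n \<in> marked a) N \<le> (2 ^ i0 + 2 * real N / real (Suc K)) / real N"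
      unfolding freq_def by (rule divide_right_mono) simp
    also have "\<dots> = 2 ^ i0 / real N + 2 / real (Suc K)" using that by (simp add: add_divide_distrib)
    finally show ?thesis .
  qed
  have "(\<lambda>N. 2 ^ i0 / real N) \<longlonglongrightarrow> 0" by (rule lim_const_over_n)
  then have "\<forall>\<^sub>F N in sequentially. 2 ^ i0 / real N < \<epsilon> / 2" using \<open>0 < \<epsilon>\<close> by (intro order_tendstoD) auto
  then show "\<forall>\<^sub>F N in sequentially. freq (\<lambda>n. n \<in> marked a) N < \<epsilon>"
    using eventually_gt_at_top[of 0]
  proof eventually_elim
    case (elim N)
    have "2 / real (Suc K) = 2 * (1 / real (Suc K))" by simp
    then show ?case using le[OF elim(2)] elim(1) K by linarith
  qed
next
  fix \<epsilon> :: real assume "\<epsilon> < 0"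
  then show "\<forall>\<^sub>F N in sequentially. \<epsilon> < freq (\<lambda>n. n \<in> marked a) N"
    by (intro always_eventually allI) (meson freq_nonneg less_le_trans)
qed

text \<open>At least \<open>2 ^ i div Suc v\<close> positions are marked in block \<open>i\<close>,
  which makes up half of the time up to \<open>2 ^ Suc i\<close>. The loss \<open>Suc m\<close>
  consists of 1 for the rounding in \<open>div\<close> and \<open>m\<close> for starts too close to
  the end of the marked stretch.\<close>

lemma freq_marked_runs:
  assumes "a i \<le> v"
  shows "1 / (2 * real (Suc v)) - real (Suc m) / real (2 ^ Suc i)
          \<le> freq (\<lambda>n. \<forall>j<m. n + j \<in> marked a) (2 ^ Suc i)"
proof -
  define L where "L = 2 ^ i div Suc v"
  have L: "L \<le> 2 ^ i div Suc (a i)" unfolding L_def using assms by (intro div_le_mono2) auto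
  have "L \<le> 2 ^ i" by (simp add: L_def)
  have "{2 ^ i..<2 ^ i + (L - m)} \<subseteq> {n. n < 2 ^ Suc i \<and> (\<forall>j<m. n + j \<in> marked a)}"
  proof (intro subsetI CollectI conjI allI impI)
    fix n j assume n: "n \<in> {2 ^ i..<2 ^ i + (L - m)}" and "j < m"
    then have "n + j \<in> {2 ^ i..<2 ^ i + 2 ^ i div Suc (a i)}" using L by auto
    then show "n + j \<in> marked a" unfolding marked_def by blast
  next
    fix n assume "n \<in> {2 ^ i..<2 ^ i + (L - m)}"
    then show "n < 2 ^ Suc i" using \<open>L \<le> 2 ^ i\<close> by auto
  qed
  then have "card {2 ^ i..<2 ^ i + (L - m)} \<le> card {n. n < 2 ^ Suc i \<and> (\<forall>j<m. n + j \<in> marked a)}"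
    by (intro card_mono) auto
  then have le: "real (L - m) / real (2 ^ Suc i) \<le> freq (\<lambda>n. \<forall>j<m. n + j \<in> marked a) (2 ^ Suc i)"
    unfolding freq_def by (intro divide_right_mono) auto
  have "real (2 ^ i) / real (Suc v) \<le> real L + 1"
  proof -
    have "2 ^ i < Suc v + L * Suc v" unfolding L_def by (rule dividend_less_div_times) simp
    then have "real (2 ^ i) \<le> real (Suc v + L * Suc v)" by (intro of_nat_mono less_imp_le)
    also have "\<dots> = (real L + 1) * real (Suc v)" by (simp add: algebra_simps)
    finally show ?thesis by (simp only: divide_le_eq) simp
  qed
  then have "real (2 ^ i) / real (Suc v) - real (Suc m) \<le> real (L - m)" by simp
  then have "(real (2 ^ i) / real (Suc v) - real (Suc m)) / real (2 ^ Suc i) \<le> real (L - m) / real (2 ^ Suc i)"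
    by (intro divide_right_mono) auto
  also have "(real (2 ^ i) / real (Suc v) - real (Suc m)) / real (2 ^ Suc i) =
      1 / (2 * real (Suc v)) - real (Suc m) / real (2 ^ Suc i)"
    by (simp add: diff_divide_distrib)
  finally show ?thesis using le by linarith
qed

section \<open>The expansion map and its cylinders\<close>

locale gls =
  fixes D :: "nat set" and l r :: "nat \<Rightarrow> real" and e :: "nat \<Rightarrow> nat"
  assumes GLS: "GLS_data D l r e" and not_singleton: "\<not> is_singleton D"
begin

abbreviation T :: "real \<Rightarrow> real" where "T \<equiv> GLS_map D l r e"

definition p :: "nat \<Rightarrow> real" where "p n = r n - l n"

text \<open>The inverse branches of \<open>T\<close>, kept affine up to \<open>y = 0\<close> and
  \<open>y = 1\<close>, where \<open>T\<close> need not invert them because \<open>r n\<close> is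
  not in the interval.\<close>

definition branch :: "nat \<Rightarrow> real \<Rightarrow> real" where
  "branch n y = (if e n = 0 then l n + p n * y else r n - p n * y)"

lemma l_less_r: "n \<in> D \<Longrightarrow> l n < r n"
  using GLS by (auto simp: GLS_data_def)

lemma p_pos: "n \<in> D \<Longrightarrow> 0 < p n"
  using l_less_r by (simp add: p_def)

lemma p_sum: "(p has_sum 1) D"
  using GLS by (simp add: GLS_data_def p_def[abs_def])

lemma interval_bounds:
  assumes "n \<in> D"
  shows "0 \<le> l n" "r n \<le> 1"
proof -
  have sub: "{l n..<r n} \<subseteq> {0..1}" using GLS assms by (auto simp: GLS_data_def)
  show "0 \<le> l n" using subsetD[OF sub, of "l n"] l_less_r[OF assms] by simp
  show "r n \<le> 1"
  proof (rule ccontr)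
    assume "\<not> r n \<le> 1"
    then have "max (l n) ((1 + r n) / 2) \<in> {l n..<r n}" using l_less_r[OF assms] by auto
    with sub \<open>\<not> r n \<le> 1\<close> show False by fastforce
  qed
qed

lemma disjoint_intervals:
  assumes "m \<in> D" "n \<in> D" "x \<in> {l m..<r m}" "x \<in> {l n..<r n}"
  shows "m = n"
  using GLS assms unfolding GLS_data_def disjoint_family_on_def by blast

lemma p_add_le:
  assumes "m \<in> D" "n \<in> D" "m \<noteq> n"
  shows "p m + p n \<le> 1"
proof -
  have "(p has_sum (p m + p n)) {m, n}" using assms by (intro has_sum_finiteI) auto
  then show ?thesis
    by (rule has_sum_mono_neutral[OF _ p_sum]) (use assms p_pos in \<open>auto intro: less_imp_le\<close>)
qed

text \<open>For a fixed digit \<open>m\<close>, every other digit has length at most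
  \<open>1 - p m\<close>, and the existence of a second digit gives \<open>p m < 1\<close>. The
  bound is thus uniform even for infinite \<open>D\<close>.\<close>

lemma contraction: "\<exists>c. 0 < c \<and> c < 1 \<and> (\<forall>n\<in>D. p n \<le> c)"
proof -
  have "D \<noteq> {}" using p_sum has_sum_unique[OF has_sum_empty, of p 1] by auto
  then obtain m where m: "m \<in> D" by blast
  then obtain n where n: "n \<in> D" "n \<noteq> m" using not_singleton is_singletonI'[of D] by blast
  have "p k \<le> max (p m) (1 - p m)" if "k \<in> D" for k
    using p_add_le[OF m that] by (cases "k = m") auto
  moreover have "p m < 1" using p_add_le[OF m n(1)] p_pos[OF n(1)] n by auto
  moreover have "0 < p m" using p_pos[OF m] .
  ultimately show ?thesis by (intro exI[of _ "max (p m) (1 - p m)"]) auto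
qed

definition c :: real where "c = (SOME c. 0 < c \<and> c < 1 \<and> (\<forall>n\<in>D. p n \<le> c))"

lemma c: "0 < c" "c < 1" "n \<in> D \<Longrightarrow> p n \<le> c"
  using someI_ex[OF contraction] unfolding c_def by auto

lemma branch_endpoints: "branch n 0 \<in> {l n, r n}" "branch n 1 \<in> {l n, r n}"
  by (auto simp: branch_def p_def)

lemma branch_interior:
  assumes "n \<in> D" "y \<in> {0<..<1}"
  shows "branch n y \<in> {l n<..<r n}"
proof -
  have "0 < p n * y" "p n * y < p n * 1"
    using assms p_pos by (auto intro: mult_pos_pos mult_strict_left_mono)
  then show ?thesis by (auto simp: branch_def p_def)
qed

lemma branch_unit: "n \<in> D \<Longrightarrow> y \<in> {0..1} \<Longrightarrow> branch n y \<in> {0..1}"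
  using branch_interior[of n y] branch_endpoints[of n] interval_bounds[of n] l_less_r[of n]
  by (cases "y = 0"; cases "y = 1") auto

text \<open>If \<open>r n\<close> belongs to some interval, disjointness makes it the left endpoint
  of that interval; otherwise \<open>T\<close> sends it to 0.\<close>

lemma T_endpoint:
  assumes "n \<in> D"
  shows "T (l n) \<in> {0, 1}" "T (r n) \<in> {0, 1}"
proof -
  have *: "T (l k) \<in> {0, 1}" if "k \<in> D" for k
    using GLS_map_eq[OF GLS that, of "l k"] l_less_r[OF that] by auto
  show "T (l n) \<in> {0, 1}" using * assms .
  show "T (r n) \<in> {0, 1}"
  proof (cases "\<exists>k\<in>D. r n \<in> {l k..<r k}")
    case True
    then obtain k where k: "k \<in> D" "r n \<in> {l k..<r k}" by blast
    have "l k = r n"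
    proof (rule ccontr)
      assume "l k \<noteq> r n"
      then have "max (l n) (l k) \<in> {l n..<r n}" "max (l n) (l k) \<in> {l k..<r k}"
        using k l_less_r[OF assms] by auto
      then have "n = k" using assms k(1) by (rule disjoint_intervals[rotated 2])
      then show False using k by simp
    qed
    then show ?thesis using *[OF k(1)] by simp
  qed (auto simp: GLS_map_def)
qed

lemma T_branch: "n \<in> D \<Longrightarrow> y \<in> {0<..<1} \<Longrightarrow> T (branch n y) = y"
  using branch_interior[of n y] GLS_map_eq[OF GLS, of n "branch n y"] p_pos[of n]
  by (auto simp: branch_def p_def)

lemma T_branch_endpoint: "n \<in> D \<Longrightarrow> y \<in> {0, 1} \<Longrightarrow> T (branch n y) \<in> {0, 1}"
  using branch_endpoints[of n] T_endpoint[of n] by auto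

lemma T_01:
  assumes "x \<in> {0, 1}"
  shows "T x \<in> {0, 1}"
proof (cases "\<exists>n\<in>D. x \<in> {l n..<r n}")
  case True
  then obtain n where "n \<in> D" "x \<in> {l n..<r n}" by blast
  with interval_bounds[of n] assms have "x = l n" by auto
  then show ?thesis using T_endpoint \<open>n \<in> D\<close> by simp
qed (auto simp: GLS_map_def)

lemma T_unit: "T x \<in> {0..1}"
proof (cases "\<exists>n\<in>D. x \<in> {l n..<r n}")
  case True
  then obtain n where "n \<in> D" "x \<in> {l n..<r n}" by blast
  then show ?thesis using GLS_map_eq[OF GLS, of n x] by auto
qed (auto simp: GLS_map_def)

lemma orbit_unit: "x \<in> {0..1} \<Longrightarrow> (T ^^ n) x \<in> {0..1}"
  using T_unit by (cases n) auto

lemma orbit_01: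
  assumes "(T ^^ m) x \<in> {0, 1}" "m \<le> n"
  shows "(T ^^ n) x \<in> {0, 1}"
  using assms(2)
proof (induction rule: dec_induct)
  case (step n)
  show ?case using T_01[OF step.IH] by simp
qed (rule assms(1))

lemma not_normal_if_endpoint:
  assumes "(T ^^ m) x \<in> {0, 1}"
  shows "\<not> GLS_normal D l r e x"
  unfolding GLS_normal_iff using orbit_01[OF assms] by (rule not_equidistributed_if_endpoints)

section \<open>Cylinders of words\<close>

text \<open>For a word over \<open>D\<close>, \<open>cyl w\<close> maps \<open>{0..1}\<close> onto
  the closed cylinder of \<open>w\<close>.\<close>

definition cyl :: "nat list \<Rightarrow> real \<Rightarrow> real" where "cyl w y = foldr branch w y"

definition weight :: "nat list \<Rightarrow> real" where "weight w = prod_list (map p w)"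

lemma cyl_simps [simp]: "cyl [] y = y" "cyl (a # w) y = branch a (cyl w y)"
  by (simp_all add: cyl_def)

lemma weight_simps [simp]: "weight [] = 1" "weight (a # w) = p a * weight w"
  by (simp_all add: weight_def)

lemma weight_pos: "set w \<subseteq> D \<Longrightarrow> 0 < weight w"
  by (induction w) (auto simp: p_pos)

lemma weight_le: "set w \<subseteq> D \<Longrightarrow> weight w \<le> c ^ length w"
proof (induction w)
  case (Cons a w)
  then have "p a * weight w \<le> c * c ^ length w"
    using c weight_pos[of w] by (intro mult_mono) (auto intro: less_imp_le)
  then show ?case by simp
qed simp

lemma cyl_unit: "set w \<subseteq> D \<Longrightarrow> y \<in> {0..1} \<Longrightarrow> cyl w y \<in> {0..1}"
proof (induction w)
  case (Cons a w)
  then show ?case using branch_unit[of a "cyl w y"] by simp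
qed simp

lemma cyl_interior: "set w \<subseteq> D \<Longrightarrow> y \<in> {0<..<1} \<Longrightarrow> cyl w y \<in> {0<..<1}"
proof (induction w)
  case (Cons a w)
  then show ?case using branch_interior[of a "cyl w y"] interval_bounds[of a] by auto
qed simp

text \<open>Branches may reverse orientation, so only the absolute slope is recorded;
  \<open>weight w\<close> also needs bars, since \<open>w\<close> is not restricted to digits in
  \<open>D\<close>.\<close>

lemma cyl_affine: "\<exists>A B. \<bar>B\<bar> = \<bar>weight w\<bar> \<and> (\<forall>y. cyl w y = A + B * y)"
proof (induction w)
  case Nil
  show ?case by (intro exI[of _ 0] exI[of _ 1]) simp
next
  case (Cons a w)
  then obtain A B where AB: "\<bar>B\<bar> = \<bar>weight w\<bar>" "\<And>y. cyl w y = A + B * y" by blast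
  show ?case
  proof (cases "e a = 0")
    case True
    then show ?thesis using AB
      by (intro exI[of _ "l a + p a * A"] exI[of _ "p a * B"]) (auto simp: branch_def abs_mult algebra_simps)
  next
    case False
    then show ?thesis using AB
      by (intro exI[of _ "r a - p a * A"] exI[of _ "- p a * B"]) (auto simp: branch_def abs_mult algebra_simps)
  qed
qed

lemma cyl_dist: "set w \<subseteq> D \<Longrightarrow> \<bar>cyl w x - cyl w y\<bar> = weight w * \<bar>x - y\<bar>"
proof -
  assume "set w \<subseteq> D"
  obtain A B where AB: "\<bar>B\<bar> = \<bar>weight w\<bar>" "\<And>y. cyl w y = A + B * y" using cyl_affine by blast
  have "cyl w x - cyl w y = B * (x - y)" by (simp add: AB(2) algebra_simps)
  then show ?thesis using weight_pos[OF \<open>set w \<subseteq> D\<close>] AB(1) by (simp add: abs_mult)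
qed

text \<open>The interval containing the common point determines the leading digit, and
  \<open>T\<close> removes it.\<close>

lemma cyl_disjoint:
  assumes "length v = length w" "set v \<subseteq> D" "set w \<subseteq> D" "x \<in> {0<..<1}" "y \<in> {0<..<1}" "cyl v x = cyl w y"
  shows "v = w"
  using assms
proof (induction v w rule: list_induct2)
  case (Cons a v b w)
  have ab: "a \<in> D" "b \<in> D" "set v \<subseteq> D" "set w \<subseteq> D" using Cons.prems by auto
  have in01: "cyl v x \<in> {0<..<1}" "cyl w y \<in> {0<..<1}" using cyl_interior Cons.prems by auto
  have "branch a (cyl v x) \<in> {l a<..<r a}" "branch b (cyl w y) \<in> {l b<..<r b}"
    using branch_interior ab in01 by blast+
  then have "a = b" using Cons.prems ab by (intro disjoint_intervals[of a b "branch a (cyl v x)"]) auto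
  moreover have "cyl v x = cyl w y"
    using T_branch[OF ab(1) in01(1)] T_branch[OF ab(2) in01(2)] Cons.prems by simp
  ultimately show ?case using Cons.IH ab Cons.prems by simp
qed simp

definition lo :: "nat list \<Rightarrow> real" where "lo w = min (cyl w 0) (cyl w 1)"
definition hi :: "nat list \<Rightarrow> real" where "hi w = max (cyl w 0) (cyl w 1)"

lemma hi_minus_lo: "set w \<subseteq> D \<Longrightarrow> hi w - lo w = weight w"
  using cyl_dist[of w 0 1] by (auto simp: lo_def hi_def)

lemma lo_hi_unit: "set w \<subseteq> D \<Longrightarrow> 0 \<le> lo w" "set w \<subseteq> D \<Longrightarrow> hi w \<le> 1"
  using cyl_unit[of w 0] cyl_unit[of w 1] by (auto simp: lo_def hi_def)

lemma cyl_range: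
  assumes "y \<in> {0..1}"
  shows "cyl w y \<in> {lo w..hi w}"
proof -
  obtain A B where AB: "\<And>y. cyl w y = A + B * y" using cyl_affine by blast
  have "B * y \<le> max 0 B" "min 0 B \<le> B * y"
    using assms mult_left_mono[of y 1 B] mult_left_mono_neg[of y 1 B] mult_nonneg_nonneg[of B y] mult_nonpos_nonneg[of B y]
    by (cases "0 \<le> B"; auto)+
  then show ?thesis by (auto simp: lo_def hi_def AB)
qed

lemma lo_le_hi: "lo w \<le> hi w"
  by (auto simp: lo_def hi_def)

lemma cyl_interior_surj:
  assumes "set w \<subseteq> D" "x \<in> {lo w<..<hi w}"
  shows "\<exists>y\<in>{0<..<1}. x = cyl w y"
proof -
  obtain A B where AB: "\<bar>B\<bar> = \<bar>weight w\<bar>" "\<And>y. cyl w y = A + B * y" using cyl_affine by blast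
  then have B: "B \<noteq> 0" using weight_pos[OF assms(1)] by auto
  then have "x = cyl w ((x - A) / B)" by (simp add: AB(2))
  moreover have "(x - A) / B \<in> {0<..<1}"
    using assms(2) B by (cases "0 < B") (auto simp: lo_def hi_def AB(2) field_simps)
  ultimately show ?thesis by blast
qed

lemma weight_total: "finite F \<Longrightarrow> (\<Sum>w | set w \<subseteq> F \<and> length w = m. weight w) = (sum p F) ^ m"
proof (induction m)
  case 0
  have "{w. set w \<subseteq> F \<and> length w = 0} = {[]}" by auto
  then show ?case by simp
next
  case (Suc m)
  let ?S = "{w. set w \<subseteq> F \<and> length w = m}"
  have "{w. set w \<subseteq> F \<and> length w = Suc m} = (\<lambda>(a, w). a # w) ` (F \<times> ?S)"
    by (auto simp: length_Suc_conv image_iff)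
  moreover have "inj_on (\<lambda>(a, w). a # w) (F \<times> ?S)" by (auto simp: inj_on_def)
  ultimately have "(\<Sum>w | set w \<subseteq> F \<and> length w = Suc m. weight w) = (\<Sum>(a, w)\<in>F \<times> ?S. p a * weight w)"
    by (simp add: sum.reindex case_prod_unfold)
  also have "\<dots> = sum p F * (\<Sum>w\<in>?S. weight w)"
    by (simp add: sum.cartesian_product[symmetric] sum_product)
  finally show ?case using Suc by simp
qed

lemma weight_sum_le_measure:
  assumes "finite S" and S: "\<And>w. w \<in> S \<Longrightarrow> set w \<subseteq> D \<and> length w = m"
    and E: "E \<in> lmeasurable" "\<And>w. w \<in> S \<Longrightarrow> {lo w<..<hi w} \<subseteq> E"
  shows "sum weight S \<le> measure lebesgue E"
proof -
  have "disjoint_family_on (\<lambda>w. {lo w<..<hi w}) S"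
    unfolding disjoint_family_on_def
  proof (intro ballI impI equals0I)
    fix v w x assume *: "v \<in> S" "w \<in> S" "v \<noteq> w" "x \<in> {lo v<..<hi v} \<inter> {lo w<..<hi w}"
    then obtain y z where "y \<in> {0<..<1}" "x = cyl v y" "z \<in> {0<..<1}" "x = cyl w z"
      using cyl_interior_surj S by (metis IntD1 IntD2)
    then show False using cyl_disjoint[of v w y z] S * by metis
  qed
  then have "measure lebesgue (\<Union>w\<in>S. {lo w<..<hi w}) = (\<Sum>w\<in>S. measure lebesgue {lo w<..<hi w})"
    using assms(1) lo_le_hi by (intro measure_finite_Union) auto
  also have "\<dots> = sum weight S"
    using S hi_minus_lo lo_le_hi by (intro sum.cong refl) simp
  finally have "sum weight S = measure lebesgue (\<Union>w\<in>S. {lo w<..<hi w})" ..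
  also have "\<dots> \<le> measure lebesgue E"
    using E assms(1) by (intro measure_mono_fmeasurable) auto
  finally show ?thesis .
qed

text \<open>Words of length \<open>m\<close> over a large finite set of digits carry nearly all the
  weight. Those whose cylinders are not inside \<open>{a..b}\<close> lie within \<open>c ^ m\<close>
  of its complement, so disjointness bounds their weight by a measure. Finitely many digits are
  taken because \<open>D\<close> may be infinite.\<close>

lemma cylinders_fill_interval:
  assumes ab: "0 \<le> a" "a \<le> b" "b \<le> 1" and \<epsilon>: "0 < \<epsilon>"
  obtains W m where "finite W" "\<And>w. w \<in> W \<Longrightarrow> set w \<subseteq> D" "\<And>w. w \<in> W \<Longrightarrow> length w = m"
    "\<And>w. w \<in> W \<Longrightarrow> {lo w..hi w} \<subseteq> {a..b}" "b - a - \<epsilon> < sum weight W"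
proof -
  \<comment> \<open>One half of \<open>\<epsilon>\<close> pays for two collars of width
    \<open>c ^ m\<close>, the other half for the omitted digits.\<close>
  obtain m where m: "c ^ m < \<epsilon> / 4" using \<epsilon> c real_arch_pow_inv[of "\<epsilon> / 4" c] by auto
  define \<delta> where "\<delta> = min 1 (\<epsilon> / (2 * real (Suc m)))"
  have \<delta>: "0 < \<delta>" "\<delta> \<le> 1" "real m * \<delta> < \<epsilon> / 2"
  proof -
    have "real m * \<delta> \<le> real m * (\<epsilon> / (2 * real (Suc m)))" by (intro mult_left_mono) (auto simp: \<delta>_def)
    also have "\<dots> < \<epsilon> / 2" using \<epsilon> by (simp add: field_simps)
    finally show "real m * \<delta> < \<epsilon> / 2" .
  qed (use \<epsilon> in \<open>auto simp: \<delta>_def\<close>)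
  have "\<forall>\<^sub>F F in finite_subsets_at_top D. 1 - \<delta> < sum p F"
    using p_sum \<delta> unfolding has_sum_def by (intro order_tendstoD) auto
  then obtain F where F: "finite F" "F \<subseteq> D" "1 - \<delta> < sum p F"
    unfolding eventually_finite_subsets_at_top by blast
  define S where "S = {w. set w \<subseteq> F \<and> length w = m}"
  have S: "finite S" using F by (simp add: S_def finite_lists_length_eq)
  have SD: "set w \<subseteq> D \<and> length w = m" if "w \<in> S" for w using that F by (auto simp: S_def)
  have "1 - real m * \<delta> \<le> (1 - \<delta>) ^ m" using Bernoulli_inequality[of "- \<delta>" m] \<delta> by simp
  also have "\<dots> \<le> (sum p F) ^ m" using F \<delta> by (intro power_mono) auto
  also have "\<dots> = sum weight S" using weight_total F by (simp add: S_def)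
  finally have tot: "1 - \<epsilon> / 2 < sum weight S" using \<delta> by linarith
  define W where "W = {w \<in> S. {lo w..hi w} \<subseteq> {a..b}}"
  let ?E = "{0..a + c ^ m} \<union> {b - c ^ m..1}"
  have "sum weight (S - W) \<le> measure lebesgue ?E"
  proof (rule weight_sum_le_measure)
    fix w assume w: "w \<in> S - W"
    then have D: "set w \<subseteq> D" "length w = m" using SD by auto
    have "hi w - lo w \<le> c ^ m" using hi_minus_lo[OF D(1)] weight_le[OF D(1)] D by simp
    moreover have "lo w < a \<or> b < hi w" using w by (auto simp: W_def)
    ultimately show "{lo w<..<hi w} \<subseteq> ?E" using lo_hi_unit[OF D(1)] by auto
  qed (use S SD in auto)
  also have "\<dots> \<le> measure lebesgue {0..a + c ^ m} + measure lebesgue {b - c ^ m..1}"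
    by (intro measure_Un_le) auto
  also have "\<dots> = a + c ^ m + (1 - (b - c ^ m))"
    using ab zero_less_power[OF c(1), of m] by simp
  finally have "sum weight (S - W) < a + 1 - b + \<epsilon> / 2" using m by linarith
  moreover have "sum weight S = sum weight W + sum weight (S - W)"
    using S by (simp add: sum.subset_diff[of W S] W_def)
  ultimately have "b - a - \<epsilon> < sum weight W" using tot by linarith
  then show ?thesis using S SD by (intro that[of W m]) (auto simp: W_def)
qed

subsection \<open>Coding points by digit sequences\<close>

text \<open>The infinite composition of affine branches, expanded as a series: the partial sums are
  \<open>cyl (map d [0..<m]) 0\<close>, and contraction gives geometric convergence.\<close>

definition point :: "(nat \<Rightarrow> nat) \<Rightarrow> real" where
  "point d = (\<Sum>n. (\<Prod>i<n. branch (d i) 1 - branch (d i) 0) * branch (d n) 0)"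

text \<open>The orbit under the digit shift, which can differ from the \<open>T\<close>-orbit of
  \<open>point d\<close> once it meets 0 or 1.\<close>

definition coded_orbit :: "(nat \<Rightarrow> nat) \<Rightarrow> nat \<Rightarrow> real" where
  "coded_orbit d n = point (\<lambda>i. d (n + i))"

lemma branch_affine: "branch n y = branch n 0 + (branch n 1 - branch n 0) * y"
  by (simp add: branch_def)

lemma point_partial_sum:
  "(\<Sum>n<m. (\<Prod>i<n. branch (d i) 1 - branch (d i) 0) * branch (d n) 0) = cyl (map d [0..<m]) 0"
proof (induction m arbitrary: d)
  case (Suc m)
  have "(\<Sum>n<Suc m. (\<Prod>i<n. branch (d i) 1 - branch (d i) 0) * branch (d n) 0)
      = branch (d 0) 0 + (branch (d 0) 1 - branch (d 0) 0) *
        (\<Sum>n<m. (\<Prod>i<n. branch (d (Suc i)) 1 - branch (d (Suc i)) 0) * branch (d (Suc n)) 0)"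
    unfolding sum.lessThan_Suc_shift prod.lessThan_Suc_shift sum_distrib_left by (simp add: mult.assoc)
  also have "\<dots> = branch (d 0) (cyl (map (\<lambda>i. d (Suc i)) [0..<m]) 0)"
    unfolding Suc[of "\<lambda>i. d (Suc i)"] by (rule branch_affine[symmetric])
  finally show ?case by (simp add: map_upt_Suc del: upt_Suc)
qed simp

lemma point_sums:
  assumes "\<And>n. d n \<in> D"
  shows "(\<lambda>n. (\<Prod>i<n. branch (d i) 1 - branch (d i) 0) * branch (d n) 0) sums point d"
proof -
  have "\<bar>\<Prod>i<n. branch (d i) 1 - branch (d i) 0\<bar> \<le> c ^ n" for n
  proof -
    have "\<bar>\<Prod>i<n. branch (d i) 1 - branch (d i) 0\<bar> = (\<Prod>i<n. \<bar>branch (d i) 1 - branch (d i) 0\<bar>)"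
      by (rule abs_prod)
    also have "\<dots> \<le> (\<Prod>i<n. c)"
    proof (intro prod_mono conjI)
      fix i
      show "\<bar>branch (d i) 1 - branch (d i) 0\<bar> \<le> c"
        using c(3)[OF assms, of i] p_pos[OF assms, of i] by (simp add: branch_def)
    qed simp
    finally show ?thesis by simp
  qed
  moreover have "\<bar>branch (d n) 0\<bar> \<le> 1" for n using branch_unit[OF assms, of 0 n] by simp
  ultimately have le: "norm ((\<Prod>i<n. branch (d i) 1 - branch (d i) 0) * branch (d n) 0) \<le> c ^ n" for n
    unfolding real_norm_def abs_mult using c(1) by (metis abs_ge_zero mult.right_neutral mult_mono zero_le_one zero_le_power less_imp_le)
  have "summable (\<lambda>n. (\<Prod>i<n. branch (d i) 1 - branch (d i) 0) * branch (d n) 0)"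
  proof (rule summable_comparison_test'[where N = 0])
    show "summable (\<lambda>n. c ^ n)" using c(1,2) by (simp add: summable_geometric)
  qed (rule le)
  then show ?thesis unfolding point_def by (rule summable_sums)
qed

lemma point_tendsto: "(\<And>n. d n \<in> D) \<Longrightarrow> (\<lambda>m. cyl (map d [0..<m]) 0) \<longlonglongrightarrow> point d"
  using point_sums[of d] unfolding sums_def point_partial_sum .

lemma point_unit:
  assumes "\<And>n. d n \<in> D"
  shows "point d \<in> {0..1}"
proof (rule closed_sequentially[OF closed_atLeastAtMost _ point_tendsto[OF assms]])
  show "cyl (map d [0..<m]) 0 \<in> {0..1}" for m by (rule cyl_unit) (use assms in auto)
qed

lemma point_rec:
  assumes "\<And>n. d n \<in> D"
  shows "point d = branch (d 0) (point (\<lambda>i. d (Suc i)))"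
proof (rule LIMSEQ_unique)
  show "(\<lambda>m. cyl (map d [0..<Suc m]) 0) \<longlonglongrightarrow> point d"
    using LIMSEQ_Suc[OF point_tendsto[of d]] assms by blast
  have "(\<lambda>m. branch (d 0) (cyl (map (\<lambda>i. d (Suc i)) [0..<m]) 0))
      \<longlonglongrightarrow> branch (d 0) (point (\<lambda>i. d (Suc i)))"
    unfolding branch_affine[of "d 0" "cyl _ _"] branch_affine[of "d 0" "point _"]
    using assms by (intro tendsto_intros point_tendsto) auto
  then show "(\<lambda>m. cyl (map d [0..<Suc m]) 0) \<longlonglongrightarrow> branch (d 0) (point (\<lambda>i. d (Suc i)))"
    by (simp add: map_upt_Suc del: upt_Suc)
qed

lemma coded_orbit_0: "coded_orbit d 0 = point d"
  by (simp add: coded_orbit_def)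

context
  fixes d :: "nat \<Rightarrow> nat"
  assumes d: "\<And>n. d n \<in> D"
begin

lemma coded_orbit_unit: "coded_orbit d n \<in> {0..1}"
  unfolding coded_orbit_def by (rule point_unit) (rule d)

lemma coded_orbit_rec: "coded_orbit d n = branch (d n) (coded_orbit d (Suc n))"
  unfolding coded_orbit_def using point_rec[of "\<lambda>i. d (n + i)"] d by simp

lemma coded_orbit_cyl: "coded_orbit d n = cyl (map d [n..<n + m]) (coded_orbit d (n + m))"
proof (induction m arbitrary: n)
  case (Suc m)
  have "coded_orbit d n = branch (d n) (cyl (map d [Suc n..<Suc n + m]) (coded_orbit d (Suc n + m)))"
    using coded_orbit_rec[of n] Suc[of "Suc n"] by simp
  then show ?case by (simp add: upt_conv_Cons del: upt_Suc)
qed simp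

lemma coded_orbit_occurs:
  assumes "occurs d w n"
  shows "coded_orbit d n \<in> {lo w..hi w}"
proof -
  have "coded_orbit d n = cyl w (coded_orbit d (n + length w))"
    using coded_orbit_cyl[of n "length w"] assms by (simp add: occurs_iff_map)
  then show ?thesis using cyl_range[OF coded_orbit_unit] by simp
qed

lemma coded_orbit_01: "coded_orbit d n \<in> {0, 1} \<Longrightarrow> coded_orbit d (Suc n) \<in> {0, 1}"
proof (rule ccontr)
  assume *: "coded_orbit d n \<in> {0, 1}" "coded_orbit d (Suc n) \<notin> {0, 1}"
  then have "coded_orbit d (Suc n) \<in> {0<..<1}" using coded_orbit_unit[of "Suc n"] by auto
  then have "coded_orbit d n \<in> {l (d n)<..<r (d n)}"
    unfolding coded_orbit_rec[of n] by (rule branch_interior[OF d])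
  then show False using * interval_bounds[OF d, of n] by auto
qed

text \<open>The two orbits agree as long as the coded one avoids \<open>{0, 1}\<close>. After a hit
  both are trapped in \<open>{0, 1}\<close>, so neither side holds.\<close>

lemma GLS_normal_point_iff: "GLS_normal D l r e (point d) \<longleftrightarrow> equidistributed (coded_orbit d)"
proof
  assume N: "GLS_normal D l r e (point d)"
  have "(T ^^ n) (point d) = coded_orbit d n" for n
  proof (induction n)
    case (Suc n)
    have *: "(T ^^ Suc n) (point d) = T (branch (d n) (coded_orbit d (Suc n)))"
      using Suc coded_orbit_rec[of n] by simp
    have "coded_orbit d (Suc n) \<notin> {0, 1}"
      using T_branch_endpoint[OF d, of "coded_orbit d (Suc n)" n] not_normal_if_endpoint[of "Suc n" "point d"] N *
      by metis
    then have "coded_orbit d (Suc n) \<in> {0<..<1}" using coded_orbit_unit[of "Suc n"] by auto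
    then show ?case using * T_branch[OF d] by simp
  qed (simp add: coded_orbit_0)
  then show "equidistributed (coded_orbit d)" using N by (simp add: GLS_normal_iff)
next
  assume E: "equidistributed (coded_orbit d)"
  have inner: "coded_orbit d n \<in> {0<..<1}" for n
  proof (rule ccontr)
    assume "coded_orbit d n \<notin> {0<..<1}"
    then have *: "coded_orbit d n \<in> {0, 1}" using coded_orbit_unit[of n] by auto
    have "coded_orbit d m \<in> {0, 1}" if "n \<le> m" for m
      using that by (induction rule: dec_induct) (rule *, rule coded_orbit_01)
    then show False using E not_equidistributed_if_endpoints[of n "coded_orbit d"] by blast
  qed
  have "(T ^^ n) (point d) = coded_orbit d n" for n
  proof (induction n)
    case (Suc n)
    then show ?case using coded_orbit_rec[of n] T_branch[OF d inner] by simp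
  qed (simp add: coded_orbit_0)
  then show "GLS_normal D l r e (point d)" using E by (simp add: GLS_normal_iff)
qed

text \<open>Lower bounds suffice, and they come from finitely many cylinders inside
  \<open>{a..b}\<close> with total weight close to \<open>b - a\<close>.\<close>

lemma word_normal_imp_equidistributed:
  assumes "\<And>w. set w \<subseteq> D \<Longrightarrow> freq (occurs d w) \<longlonglongrightarrow> weight w"
  shows "equidistributed (coded_orbit d)"
  unfolding equidistributed_iff[of "coded_orbit d", OF coded_orbit_unit]
proof (intro ballI allI impI)
  fix a b :: real and k :: nat assume ab: "0 \<le> a \<and> a < b \<and> b \<le> 1"
  then obtain W m where W: "finite W" "\<And>w. w \<in> W \<Longrightarrow> set w \<subseteq> D" "\<And>w. w \<in> W \<Longrightarrow> length w = m"
    "\<And>w. w \<in> W \<Longrightarrow> {lo w..hi w} \<subseteq> {a..b}" "b - a - 1 / real (Suc k) < sum weight W"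
    using cylinders_fill_interval[of a b "1 / real (Suc k)"] by auto
  have "(\<lambda>N. \<Sum>w\<in>W. freq (occurs d w) N) \<longlonglongrightarrow> sum weight W"
    using W assms by (intro tendsto_sum) auto
  then have "\<forall>\<^sub>F N in sequentially. b - a - 1 / real (Suc k) < (\<Sum>w\<in>W. freq (occurs d w) N)"
    using W(5) by (rule order_tendstoD)
  then show "\<forall>\<^sub>F N in sequentially. b - a - 1 / real (Suc k) \<le> freq (\<lambda>n. coded_orbit d n \<in> {a..b}) N"
  proof eventually_elim
    case (elim N)
    have "(\<Sum>w\<in>W. freq (occurs d w) N) = freq (\<lambda>n. \<exists>w\<in>W. occurs d w n) N"
      using W by (intro freq_Un[symmetric]) (auto simp: occurs_iff_map)
    also have "\<dots> \<le> freq (\<lambda>n. coded_orbit d n \<in> {a..b}) N"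
      using W(4) coded_orbit_occurs by (intro freq_mono) blast
    finally show ?case using elim by linarith
  qed
qed

end

section \<open>Reduction from divergent sequences\<close>

lemma point_agree:
  assumes d: "\<And>n. d n \<in> D" and d': "\<And>n. d' n \<in> D" and eq: "\<And>i. i < m \<Longrightarrow> d i = d' i"
  shows "\<bar>point d - point d'\<bar> \<le> c ^ m"
proof -
  let ?w = "map d [0..<m]"
  have w: "set ?w \<subseteq> D" using d by auto
  have "?w = map d' [0..<m]" using eq by auto
  then have "point d' = cyl ?w (coded_orbit d' m)"
    using coded_orbit_cyl[of d' 0 m, OF d'] by (metis add_0 coded_orbit_0)
  moreover have "point d = cyl ?w (coded_orbit d m)"
    using coded_orbit_cyl[of d 0 m, OF d] by (simp add: coded_orbit_0)
  ultimately have "\<bar>point d - point d'\<bar> = weight ?w * \<bar>coded_orbit d m - coded_orbit d' m\<bar>"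
    using cyl_dist[OF w] by simp
  also have "\<dots> \<le> weight ?w * 1"
    using coded_orbit_unit[of d m, OF d] coded_orbit_unit[of d' m, OF d'] weight_pos[OF w]
    by (intro mult_left_mono) (auto simp: abs_le_iff)
  also have "\<dots> \<le> c ^ m" using weight_le[OF w] by simp
  finally show ?thesis .
qed

text \<open>\<open>f a\<close> is coded by a word-normal sequence with one digit written over the
  marked positions. A divergent \<open>a\<close> changes a set of frequency 0; otherwise runs of
  that digit are too frequent at infinitely many block ends.\<close>

lemma exists_reduction:
  "\<exists>f :: (nat \<Rightarrow> nat) \<Rightarrow> real. (\<forall>a. f a \<in> {0..1}) \<and>
     (\<forall>a. GLS_normal D l r e (f a) \<longleftrightarrow> filterlim a at_top sequentially) \<and>
     (\<forall>U. open U \<longrightarrow> prefix_open {a. f a \<in> U})"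
proof -
  obtain g where g: "\<And>n. g n \<in> D" "\<And>w. set w \<subseteq> D \<Longrightarrow> freq (occurs g w) \<longlonglongrightarrow> weight w"
    using exists_word_normal[OF less_imp_le[OF p_pos] p_sum] unfolding weight_def by blast
  define b where "b = g 0"
  define d where "d = (\<lambda>a n. if n \<in> marked a then b else g n)"
  have bD: "b \<in> D" and dD: "d a n \<in> D" for a n using g(1) by (auto simp: b_def d_def)
  show ?thesis
  proof (intro exI[of _ "\<lambda>a. point (d a)"] conjI allI impI)
    show "point (d a) \<in> {0..1}" for a by (rule point_unit) (rule dD)
    show "prefix_open {a. point (d a) \<in> U}" if "open U" for U
      unfolding prefix_open_def
    proof (intro ballI)
      fix a assume "a \<in> {a. point (d a) \<in> U}"
      then obtain \<epsilon> where \<epsilon>: "0 < \<epsilon>" "\<And>y. dist y (point (d a)) < \<epsilon> \<Longrightarrow> y \<in> U"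
        using \<open>open U\<close> unfolding open_dist by blast
      obtain m where m: "c ^ m < \<epsilon>" using \<epsilon> c real_arch_pow_inv by blast
      have "point (d a') \<in> U" if "\<forall>i<m. a' i = a i" for a'
      proof (rule \<epsilon>(2))
        have "d a' i = d a i" if "i < m" for i
        proof -
          have "i < 2 ^ m" using that less_exp[of m] by linarith
          then show ?thesis using marked_cong[of m a' a i] \<open>\<forall>i<m. a' i = a i\<close> by (simp add: d_def)
        qed
        then have "\<bar>point (d a') - point (d a)\<bar> \<le> c ^ m" by (intro point_agree dD)
        then show "dist (point (d a')) (point (d a)) < \<epsilon>" using m by (simp add: dist_real_def)
      qed
      then show "\<exists>n. \<forall>a'. (\<forall>i<n. a' i = a i) \<longrightarrow> a' \<in> {a. point (d a) \<in> U}" by blast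
    qed
    fix a
    have "equidistributed (coded_orbit (d a)) \<longleftrightarrow> filterlim a at_top sequentially"
    proof
      assume "filterlim a at_top sequentially"
      then have *: "freq (\<lambda>n. n \<in> marked a) \<longlonglongrightarrow> 0" by (rule freq_marked)
      have "freq (\<lambda>n. g n \<noteq> d a n) \<longlonglongrightarrow> 0"
        by (rule tendsto_sandwich[OF _ _ tendsto_const *])
           (auto simp: freq_nonneg d_def intro!: always_eventually freq_mono)
      then have "freq (occurs (d a) w) \<longlonglongrightarrow> weight w" if "set w \<subseteq> D" for w
        using g(2)[OF that] by (rule freq_occurs_perturb)
      then show "equidistributed (coded_orbit (d a))"
        by (intro word_normal_imp_equidistributed dD) auto
    next
      assume E: "equidistributed (coded_orbit (d a))"
      show "filterlim a at_top sequentially"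
      proof (rule ccontr)
        assume "\<not> filterlim a at_top sequentially"
        then obtain v where v: "\<exists>\<^sub>F i in sequentially. \<not> v \<le> a i"
          unfolding filterlim_at_top by (auto simp: not_eventually)
        \<comment> \<open>At the end of a block with \<open>a i \<le> v\<close>, starts of runs of
          \<open>b\<close> have frequency at least \<open>\<eta>\<close> up to a vanishing error.
          The length \<open>m\<close> is chosen so that normality permits less than
          \<open>\<eta> / 2\<close>.\<close>
        define \<eta> where "\<eta> = 1 / (2 * real (Suc v))"
        have "0 < \<eta>" by (simp add: \<eta>_def)
        then obtain m where m: "c ^ m < \<eta> / 2" using c real_arch_pow_inv[of "\<eta> / 2" c] by auto
        let ?w = "replicate m b"
        have w: "set ?w \<subseteq> D" using bD by auto
        have "weight ?w < \<eta> / 2" using weight_le[OF w] m by simp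
        have "{lo ?w..hi ?w} \<subseteq> {0..1}" using lo_hi_unit[OF w] by auto
        then have "freq (\<lambda>n. coded_orbit (d a) n \<in> {lo ?w..hi ?w}) \<longlonglongrightarrow>
            measure (lebesgue_on {0..1}) {lo ?w..hi ?w}"
          using E is_interval_cc unfolding equidistributed_def by blast
        also have "measure (lebesgue_on {0..1}) {lo ?w..hi ?w} = hi ?w - lo ?w"
          using \<open>{lo ?w..hi ?w} \<subseteq> {0..1}\<close> lo_le_hi by (intro measure_unit_interval) auto
        also have "\<dots> = weight ?w" by (rule hi_minus_lo[OF w])
        finally have "\<forall>\<^sub>F N in sequentially. freq (\<lambda>n. coded_orbit (d a) n \<in> {lo ?w..hi ?w}) N < \<eta> / 2"
          using \<open>weight ?w < \<eta> / 2\<close> by (rule order_tendstoD)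
        moreover have pow: "filterlim (\<lambda>i. 2 ^ Suc i :: nat) at_top sequentially"
          by (intro filterlim_subseq strict_monoI) simp
        ultimately have "\<forall>\<^sub>F i in sequentially. freq (\<lambda>n. coded_orbit (d a) n \<in> {lo ?w..hi ?w}) (2 ^ Suc i) < \<eta> / 2"
          by (rule eventually_compose_filterlim)
        moreover have "(\<lambda>N. real (Suc m) / real N) \<longlonglongrightarrow> 0" by (rule lim_const_over_n)
        then have "\<forall>\<^sub>F N in sequentially. real (Suc m) / real N < \<eta> / 2"
          using \<open>0 < \<eta>\<close> by (intro order_tendstoD) auto
        then have "\<forall>\<^sub>F i in sequentially. real (Suc m) / real (2 ^ Suc i) < \<eta> / 2"
          using pow by (rule eventually_compose_filterlim)
        ultimately have "\<forall>\<^sub>F i in sequentially. v \<le> a i"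
        proof eventually_elim
          case (elim i)
          show ?case
          proof (rule ccontr)
            assume "\<not> v \<le> a i"
            then have "\<eta> - real (Suc m) / real (2 ^ Suc i) \<le> freq (\<lambda>n. \<forall>j<m. n + j \<in> marked a) (2 ^ Suc i)"
              unfolding \<eta>_def by (intro freq_marked_runs) simp
            also have "\<dots> \<le> freq (\<lambda>n. coded_orbit (d a) n \<in> {lo ?w..hi ?w}) (2 ^ Suc i)"
              by (intro freq_mono coded_orbit_occurs dD) (auto simp: occurs_def d_def)
            finally show False using elim by linarith
          qed
        qed
        then show False using v by (simp add: frequently_def)
      qed
    qed
    then show "GLS_normal D l r e (point (d a)) \<longleftrightarrow> filterlim a at_top sequentially"
      using GLS_normal_point_iff[of "d a", OF dD] by simp
  qed
qed

text \<open>Preimages under the reduction commute with unions and intersections, so such a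
  representation would pull back to the divergent sequences.\<close>

lemma normal_not_Sigma_3:
  "{x \<in> {0..1}. GLS_normal D l r e x} \<notin> bold_Sigma (top_of_set {0..1}) 3"
proof
  assume "{x \<in> {0..1}. GLS_normal D l r e x} \<in> bold_Sigma (top_of_set {0..1}) 3"
  then obtain F where F: "countable F" "\<And>A. A \<in> F \<Longrightarrow> gdelta_in (top_of_set {0..1}) A"
    "{x \<in> {0..1}. GLS_normal D l r e x} = \<Union>F"
    unfolding bold_Sigma_3 by blast
  obtain f :: "(nat \<Rightarrow> nat) \<Rightarrow> real" where f: "\<And>a. f a \<in> {0..1}"
    "\<And>a. GLS_normal D l r e (f a) \<longleftrightarrow> filterlim a at_top sequentially"
    "\<And>U. open U \<Longrightarrow> prefix_open {a. f a \<in> U}"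
    using exists_reduction by blast
  \<comment> \<open>Inserting \<open>{}\<close> allows an enumeration by \<open>nat\<close> even if
    \<open>F\<close> is empty.\<close>
  define G where "G = from_nat_into (insert {} F)"
  have range_G: "range G = insert {} F" using F(1) by (simp add: G_def range_from_nat_into)
  have "\<exists>C :: nat \<Rightarrow> real set. (\<forall>j. open (C j)) \<and> G k = {0..1} \<inter> (\<Inter>j. C j)" for k
  proof -
    have "G k \<in> insert {} F" using range_G by blast
    then have "gdelta_in (top_of_set {0..1}) (G k)" using F(2) by auto
    then obtain A :: "nat \<Rightarrow> real set" where A: "\<And>j. openin (top_of_set {0..1}) (A j)" "\<Inter>(range A) = G k"
      unfolding gdelta_in_descending by auto
    then have "\<exists>B. open B \<and> A j = {0..1} \<inter> B" for j unfolding openin_open by blast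
    then obtain C where C: "\<And>j. open (C j)" "\<And>j. A j = {0..1} \<inter> C j" by metis
    then show ?thesis using A(2) by (intro exI[of _ C]) auto
  qed
  then obtain C :: "nat \<Rightarrow> nat \<Rightarrow> real set" where C: "\<And>k j. open (C k j)" "\<And>k. G k = {0..1} \<inter> (\<Inter>j. C k j)" by metis
  have "filterlim a at_top sequentially \<longleftrightarrow> (\<exists>k. \<forall>j. f a \<in> C k j)" for a
  proof -
    have "filterlim a at_top sequentially \<longleftrightarrow> f a \<in> {x \<in> {0..1}. GLS_normal D l r e x}"
      using f(1,2)[of a] by simp
    also have "\<dots> \<longleftrightarrow> f a \<in> \<Union>(range G)" using F(3) range_G by simp
    also have "\<dots> \<longleftrightarrow> (\<exists>k. \<forall>j. f a \<in> C k j)" using C(2) f(1)[of a] by auto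
    finally show ?thesis .
  qed
  then have "{a. filterlim a at_top sequentially} = (\<Union>k. \<Inter>j. {a. f a \<in> C k j})"
    by blast
  moreover have "prefix_open {a. f a \<in> C k j}" for k j using f(3) C(1) by blast
  ultimately show False using divergent_sequences_not_Sigma_3[of "\<lambda>k j. {a. f a \<in> C k j}"] by blast
qed

subsection \<open>Upper bound\<close>

definition interiors :: "real set" where "interiors = (\<Union>n\<in>D. {l n<..<r n})"

text \<open>Only the iterates below \<open>n\<close> are constrained, which is enough for
  \<open>T ^^ n\<close> to be continuous on this set.\<close>

definition regular :: "nat \<Rightarrow> real set" where
  "regular n = {x. \<forall>j<n. (T ^^ j) x \<in> interiors}"

lemma open_interiors: "open interiors"
  by (auto simp: interiors_def)

lemma continuous_on_T: "continuous_on interiors T"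
  unfolding interiors_def
proof (rule continuous_on_open_UN)
  fix n assume n: "n \<in> D"
  have "continuous_on {l n<..<r n} (\<lambda>x. if e n = 0 then (x - l n) / (r n - l n) else (r n - x) / (r n - l n))"
    using l_less_r[OF n] by (cases "e n = 0") (auto intro!: continuous_intros)
  then show "continuous_on {l n<..<r n} T"
    by (rule continuous_on_eq) (simp add: GLS_map_eq[OF GLS n])
qed simp

lemma regular_Suc: "regular (Suc n) = regular n \<inter> (T ^^ n) -` interiors"
  by (auto simp: regular_def less_Suc_eq)

lemma regular_antimono: "m \<le> n \<Longrightarrow> regular n \<subseteq> regular m"
  by (auto simp: regular_def)

lemma regular_open_continuous: "open (regular n) \<and> continuous_on (regular n) (T ^^ n)"
proof (induction n)
  case 0
  then show ?case by (simp add: regular_def continuous_on_id)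
next
  case (Suc n)
  then have "open (regular n \<inter> (T ^^ n) -` interiors)"
    using open_interiors by (auto intro: continuous_open_preimage)
  moreover have "continuous_on (regular n \<inter> (T ^^ n) -` interiors) (T \<circ> T ^^ n)"
  proof (rule continuous_on_compose)
    show "continuous_on (regular n \<inter> (T ^^ n) -` interiors) (T ^^ n)"
      by (rule continuous_on_subset[OF conjunct2[OF Suc]]) simp
    show "continuous_on ((T ^^ n) ` (regular n \<inter> (T ^^ n) -` interiors)) T"
      by (rule continuous_on_subset[OF continuous_on_T]) auto
  qed
  ultimately show ?case by (simp add: regular_Suc)
qed

text \<open>A point outside \<open>interiors\<close> is a left endpoint or lies in no interval; in
  both cases \<open>T\<close> sends it into \<open>{0, 1}\<close>.\<close>

lemma normal_regular:
  assumes "GLS_normal D l r e x" "x \<in> {0..1}"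
  shows "x \<in> regular n"
proof (rule ccontr)
  assume "x \<notin> regular n"
  then obtain j where j: "(T ^^ j) x \<notin> interiors" by (auto simp: regular_def)
  have "T ((T ^^ j) x) \<in> {0, 1}"
  proof (cases "\<exists>n\<in>D. (T ^^ j) x \<in> {l n..<r n}")
    case True
    then obtain n where n: "n \<in> D" "(T ^^ j) x \<in> {l n..<r n}" by blast
    with j have "(T ^^ j) x = l n" by (force simp: interiors_def)
    then show ?thesis using T_endpoint(1)[OF n(1)] by simp
  qed (auto simp: GLS_map_def)
  then show False using not_normal_if_endpoint[of "Suc j" x] assms(1) by simp
qed

text \<open>For a fixed small set \<open>A\<close> of permitted visiting times, all other times must
  avoid the closed set \<open>S\<close>, an open condition because finitely many continuous iterates
  are involved.\<close>

lemma open_low_frequency: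
  assumes "closed S"
  shows "open {x \<in> regular N. freq (\<lambda>n. (T ^^ n) x \<in> S) N < q}"
proof -
  let ?P = "{A. A \<subseteq> {..<N} \<and> real (card A) / real N < q}"
  have "{x \<in> regular N. freq (\<lambda>n. (T ^^ n) x \<in> S) N < q} =
      (\<Union>A\<in>?P. regular N \<inter> (\<Inter>n\<in>{..<N} - A. regular n \<inter> (T ^^ n) -` (- S)))"
  proof (intro subset_antisym subsetI)
    fix x assume x: "x \<in> {x \<in> regular N. freq (\<lambda>n. (T ^^ n) x \<in> S) N < q}"
    let ?A = "{n. n < N \<and> (T ^^ n) x \<in> S}"
    have "x \<in> regular n" if "n < N" for n using x regular_antimono[of n N] that by auto
    then have "x \<in> regular N \<inter> (\<Inter>n\<in>{..<N} - ?A. regular n \<inter> (T ^^ n) -` (- S))" using x by auto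
    moreover have "?A \<in> ?P" using x by (auto simp: freq_def)
    ultimately show "x \<in> (\<Union>A\<in>?P. regular N \<inter> (\<Inter>n\<in>{..<N} - A. regular n \<inter> (T ^^ n) -` (- S)))"
      by (rule UN_I[rotated])
  next
    fix x assume "x \<in> (\<Union>A\<in>?P. regular N \<inter> (\<Inter>n\<in>{..<N} - A. regular n \<inter> (T ^^ n) -` (- S)))"
    then obtain A where "A \<in> ?P" and x: "x \<in> regular N \<inter> (\<Inter>n\<in>{..<N} - A. regular n \<inter> (T ^^ n) -` (- S))"
      by (rule UN_E)
    then have A: "A \<subseteq> {..<N}" "real (card A) / real N < q" by auto
    have "finite A" using A(1) by (rule finite_subset) simp
    then have "card {n. n < N \<and> (T ^^ n) x \<in> S} \<le> card A" using x by (intro card_mono) auto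
    then have "freq (\<lambda>n. (T ^^ n) x \<in> S) N \<le> real (card A) / real N"
      unfolding freq_def by (intro divide_right_mono) auto
    then show "x \<in> {x \<in> regular N. freq (\<lambda>n. (T ^^ n) x \<in> S) N < q}" using A x by auto
  qed
  moreover have piece: "open (regular n \<inter> (T ^^ n) -` (- S))" for n
    using regular_open_continuous[of n] assms by (intro continuous_open_preimage) (auto simp: open_Compl)
  ultimately show ?thesis
    using conjunct1[OF regular_open_continuous]
    by (simp only:) (intro open_UN ballI open_Int[of "regular N"] open_INT finite_Diff finite_lessThan)
qed

text \<open>A limsup of open sets, hence a G-delta set. Membership in \<open>regular N\<close> for
  unboundedly large \<open>N\<close> builds in regularity of the whole orbit.\<close>

definition deficient :: "real \<times> real \<times> nat \<Rightarrow> real set" where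
  "deficient = (\<lambda>(a, b, k). \<Inter>M. \<Union>N\<in>{M..}.
     {x \<in> regular N. freq (\<lambda>n. (T ^^ n) x \<in> {a..b}) N < b - a - 1 / real (Suc k)})"

lemma deficient_iff:
  "x \<in> deficient (a, b, k) \<longleftrightarrow> (\<forall>n. x \<in> regular n) \<and>
     \<not> (\<forall>\<^sub>F N in sequentially. b - a - 1 / real (Suc k) \<le> freq (\<lambda>n. (T ^^ n) x \<in> {a..b}) N)"
proof -
  have "x \<in> deficient (a, b, k) \<longleftrightarrow> (\<forall>M. \<exists>N\<ge>M. x \<in> regular N \<and>
      freq (\<lambda>n. (T ^^ n) x \<in> {a..b}) N < b - a - 1 / real (Suc k))"
    by (auto simp: deficient_def)
  also have "\<dots> \<longleftrightarrow> (\<forall>n. x \<in> regular n) \<and> (\<forall>M. \<exists>N\<ge>M.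
      freq (\<lambda>n. (T ^^ n) x \<in> {a..b}) N < b - a - 1 / real (Suc k))"
    using regular_antimono by blast
  finally show ?thesis by (simp add: eventually_sequentially not_le)
qed

lemma gdelta_deficient: "gdelta_in (top_of_set {0..1}) ({0..1} \<inter> deficient (a, b, k))"
proof -
  have "gdelta_in euclidean (deficient (a, b, k))"
    unfolding deficient_def prod.case
    by (intro gdelta_in_Inter)
       (auto simp del: atLeastAtMost_iff intro!: open_imp_gdelta_in open_UN open_low_frequency)
  then show ?thesis unfolding gdelta_in_subtopology by blast
qed

text \<open>The complement splits into the relatively closed sets of non-regular points and the sets
  \<open>deficient t\<close> with rational parameters, so continuity of the iterates is used only on
  regular points.\<close>

lemma normal_Pi_3:
  "{x \<in> {0..1}. GLS_normal D l r e x} \<in> bold_Pi (top_of_set {0..1}) 3"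
proof -
  define Q where "Q = {(a, b, k :: nat). a \<in> \<rat> \<and> b \<in> \<rat> \<and> (0::real) \<le> a \<and> a < b \<and> b \<le> 1}"
  define F where "F = range (\<lambda>n. {0..1} - regular n) \<union> (\<lambda>t. {0..1} \<inter> deficient t) ` Q"
  have "Q \<subseteq> \<rat> \<times> \<rat> \<times> UNIV" by (auto simp: Q_def)
  then have "countable Q"
    by (rule countable_subset) (auto intro!: countable_SIGMA countable_rat)
  then have "countable F" by (simp add: F_def)
  moreover have "gdelta_in (top_of_set {0..1}) A" if "A \<in> F" for A
  proof -
    have "gdelta_in (top_of_set {0..1}) ({0..1} - regular n)" for n
    proof (rule closed_imp_gdelta_in)
      show "metrizable_space (top_of_set {0..1::real})"
        by (simp add: metrizable_space_euclidean metrizable_space_subtopology)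
      show "closedin (top_of_set {0..1}) ({0..1} - regular n)"
        using regular_open_continuous[of n] by (intro closed_subset) (auto intro: closed_Diff)
    qed
    then show ?thesis using that gdelta_deficient by (auto simp: F_def)
  qed
  moreover have "{0..1} - {x \<in> {0..1}. GLS_normal D l r e x} = \<Union>F"
  proof (intro subset_antisym subsetI)
    fix x assume x: "x \<in> {0..1} - {x \<in> {0..1}. GLS_normal D l r e x}"
    show "x \<in> \<Union>F"
    proof (cases "\<forall>n. x \<in> regular n")
      case True
      have "\<not> equidistributed (\<lambda>n. (T ^^ n) x)" using x by (simp add: GLS_normal_iff)
      then obtain a b k where "a \<in> \<rat>" "b \<in> \<rat>" "0 \<le> a \<and> a < b \<and> b \<le> 1"
        "\<not> (\<forall>\<^sub>F N in sequentially. b - a - 1 / real (Suc k) \<le> freq (\<lambda>n. (T ^^ n) x \<in> {a..b}) N)"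
        using equidistributed_iff[of "\<lambda>n. (T ^^ n) x", OF orbit_unit] x by blast
      then have "(a, b, k) \<in> Q" "x \<in> deficient (a, b, k)" using True by (auto simp: Q_def deficient_iff)
      then show ?thesis using x by (auto simp: F_def)
    qed (use x in \<open>auto simp: F_def\<close>)
  next
    fix x assume "x \<in> \<Union>F"
    then consider n where "x \<in> {0..1} - regular n"
      | a b k where "(a, b, k) \<in> Q" "x \<in> {0..1}" "x \<in> deficient (a, b, k)"
      by (auto simp: F_def)
    then show "x \<in> {0..1} - {x \<in> {0..1}. GLS_normal D l r e x}"
    proof cases
      case 1
      then show ?thesis using normal_regular by blast
    next
      case 2
      then have "\<not> equidistributed (\<lambda>n. (T ^^ n) x)"
        using equidistributed_iff[of "\<lambda>n. (T ^^ n) x", OF orbit_unit] by (auto simp: deficient_iff Q_def)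
      then show ?thesis using 2 by (simp add: GLS_normal_iff)
    qed
  qed
  ultimately have "{0..1} - {x \<in> {0..1}. GLS_normal D l r e x} \<in> bold_Sigma (top_of_set {0..1}) 3"
    unfolding bold_Sigma_3 by blast
  then have "{0..1} - ({0..1} - {x \<in> {0..1}. GLS_normal D l r e x}) \<in> bold_Pi (top_of_set {0..1}) 3"
    unfolding bold_Pi_def by force
  also have "{0..1} - ({0..1} - {x \<in> {0..1}. GLS_normal D l r e x}) = {x \<in> {0..1}. GLS_normal D l r e x}"
    by blast
  finally show ?thesis .
qed

end

theorem corollary12:
  fixes D :: "nat set" and l r :: "nat \<Rightarrow> real" and e :: "nat \<Rightarrow> nat"
  assumes "GLS_data D l r e"
    and "\<not> is_singleton D"
  shows "Pi3_complete (top_of_set {0..1::real}) {x \<in> {0..1}. GLS_normal D l r e x}"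
proof -
  interpret gls D l r e by unfold_locales (fact assms)+
  show ?thesis unfolding Pi3_complete_def using normal_Pi_3 normal_not_Sigma_3 by blast
qed

end
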